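(* Let $\Omega\subset\mathbb{R}^N$, $N\ge2$, be a bounded domain of class $C^2$ and let $h:\Omega\times\mathbb{R}\to\mathbb{R}$ satisfy: $(h_1)$ $h$ is a Carathéodory function and for every $\varrho>0$ there exists $\alpha_\varrho\in L^\infty(\Omega)$ such that $|h(x,s)|\le\alpha_\varrho(x)$ for a.e. $x\in\Omega$ and all $|s|\le\varrho$. Let $\lambda\in\mathbb{R}$ be fixed and let $M>0$ be such that, for every $\mu\ge M$, $u_\mu$ is a solution of $$ -\operatorname{div}\left(\frac{\nabla u}{\sqrt{1-|\nabla u|^2}}\right)=\lambda u+\mu h(x,u)\ \text{ in }\Omega,\qquad u=0\ \text{ on }\partial\Omega, \tag{P$_\mu$} $$ satisfying $$ I_\mu(u_\mu)=\inf_{u\in C(\overline\Omega)}I_\mu(u). $$ Then, up to a subsequence (i.e. along a subsequence of any given sequence $\mu_n\to+\infty$), $$ u_\mu\to u_\infty\quad\text{uniformly in }\overline\Omega\quad\text{as }\mu\to+\infty, $$ where $u_\infty$ solves the maximum problem $$ \max_{u\in K_0}\int_\Omega H(x,u)\,dx. $$ In particular, if in addition there exists $\delta>0$ such that $h(x,s)s>0$ for a.e. $x\in\Omega$ and all $s\in(-\delta,\delta)\setminus\{0\}$, the same conclusion holds for any family $\{u_\mu^{(l)}\}_{\mu>\widetilde\mu}$ (for some $\widetilde\mu\in\mathbb{R}$) of nontrivial solutions of (P$_\mu$) with $I_\mu(u_\mu^{(l)})=\inf_{u\in C(\overline\Omega)}I_\mu(u)<0$ for every $\mu>\widetilde\m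u$.
   Context: A solution of (P$_\mu$) is a function $u\in W^{2,q}(\Omega)$ for some $q>N$ such that $\|\nabla u\|_{L^\infty(\Omega)}<1$, $u$ satisfies the equation a.e. in $\Omega$, and $u$ vanishes on $\partial\Omega$. Set $K_0:=\{u\in W^{1,\infty}(\Omega):\|\nabla u\|_{L^\infty(\Omega)}\le1,\ u=0\text{ on }\partial\Omega\}$ and $H(x,s):=\int_0^sh(x,\tau)\,d\tau$. For fixed $\lambda$, the functional $I_\mu:C(\overline\Omega)\to(-\infty,+\infty]$ is $$ I_\mu(u):=\Psi(u)-\frac\lambda2\int_\Omega u^2\,dx-\mu\int_\Omega H(x,u)\,dx, $$ where $\Psi(u):=\int_\Omega\left(1-\sqrt{1-|\nabla u|^2}\right)dx$ if $u\in K_0$ and $\Psi(u):=+\infty$ if $u\in C(\overline\Omega)\setminus K_0$. *)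

theory Defs
  imports "HOL-Analysis.Analysis" "HOL-Probability.Essential_Supremum"
begin

section \<open>Classical smoothness and domains of class $C^k$\<close>

text \<open>Meant for open \<open>S\<close> only, where \<open>at x within S\<close> and \<open>at x\<close> agree.\<close>

primrec Ck_on :: "nat \<Rightarrow> 'a::euclidean_space set \<Rightarrow> ('a \<Rightarrow> real) \<Rightarrow> bool" where
  "Ck_on 0 S f \<longleftrightarrow> continuous_on S f"
| "Ck_on (Suc k) S f \<longleftrightarrow> f differentiable_on S \<and>
     (\<forall>b\<in>Basis. Ck_on k S (\<lambda>x. frechet_derivative f (at x) b))"

text \<open>
  Near each boundary point the set is the part of a ball lying above the graph of a $C^k$ function
  of the coordinates orthogonal to some direction \<open>e\<close> (the coordinate axes may be rotated).
  The graph function \<open>\<gamma>\<close> is defined on the whole space, but only its values on the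
  hyperplane orthogonal to \<open>e\<close> enter.
\<close>

definition Ck_boundary :: "nat \<Rightarrow> 'a::euclidean_space set \<Rightarrow> bool" where
  "Ck_boundary k \<Omega> \<longleftrightarrow> (\<forall>x0\<in>frontier \<Omega>. \<exists>r>0. \<exists>e \<gamma>. norm e = 1 \<and> Ck_on k UNIV \<gamma> \<and>
     \<Omega> \<inter> ball x0 r = {x \<in> ball x0 r. x \<bullet> e > \<gamma> (x - (x \<bullet> e) *\<^sub>R e)})"

definition bounded_Ck_domain :: "nat \<Rightarrow> 'a::euclidean_space set \<Rightarrow> bool" where
  "bounded_Ck_domain k \<Omega> \<longleftrightarrow>
     open \<Omega> \<and> connected \<Omega> \<and> \<Omega> \<noteq> {} \<and> bounded \<Omega> \<and> Ck_boundary k \<Omega>"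


section \<open>Weak derivatives and Sobolev spaces\<close>

text \<open>Functions are not identified up to null sets; all spaces below are spaces of functions.\<close>

definition test_function :: "'a::euclidean_space set \<Rightarrow> ('a \<Rightarrow> real) \<Rightarrow> bool" where
  "test_function \<Omega> \<phi> \<longleftrightarrow> (\<forall>k. Ck_on k UNIV \<phi>) \<and>
     compact (closure {x. \<phi> x \<noteq> 0}) \<and> closure {x. \<phi> x \<noteq> 0} \<subseteq> \<Omega>"

definition locally_integrable :: "'a::euclidean_space set \<Rightarrow> ('a \<Rightarrow> real) \<Rightarrow> bool" where
  "locally_integrable \<Omega> f \<longleftrightarrow> (\<forall>K. compact K \<and> K \<subseteq> \<Omega> \<longrightarrow> f absolutely_integrable_on K)"

definition has_weak_partial ::
    "'a::euclidean_space set \<Rightarrow> 'a \<Rightarrow> ('a \<Rightarrow> real) \<Rightarrow> ('a \<Rightarrow> real) \<Rightarrow> bool" where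
  "has_weak_partial \<Omega> b u v \<longleftrightarrow> locally_integrable \<Omega> u \<and> locally_integrable \<Omega> v \<and>
     (\<forall>\<phi>. test_function \<Omega> \<phi> \<longrightarrow>
        (LINT x|lebesgue_on \<Omega>. u x * frechet_derivative \<phi> (at x) b)
          = - (LINT x|lebesgue_on \<Omega>. v x * \<phi> x))"

text \<open>Weak partial derivatives are unique up to a null set, so that the choice is immaterial
  wherever \<open>weak_partial\<close> is used below.\<close>

definition weak_partial :: "'a::euclidean_space set \<Rightarrow> 'a \<Rightarrow> ('a \<Rightarrow> real) \<Rightarrow> 'a \<Rightarrow> real" where
  "weak_partial \<Omega> b u = (SOME v. has_weak_partial \<Omega> b u v)"

definition weak_grad :: "'a::euclidean_space set \<Rightarrow> ('a \<Rightarrow> real) \<Rightarrow> 'a \<Rightarrow> 'a" where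
  "weak_grad \<Omega> u x = (\<Sum>b\<in>Basis. weak_partial \<Omega> b u x *\<^sub>R b)"

definition weak_div :: "'a::euclidean_space set \<Rightarrow> ('a \<Rightarrow> 'a) \<Rightarrow> 'a \<Rightarrow> real" where
  "weak_div \<Omega> F x = (\<Sum>b\<in>Basis. weak_partial \<Omega> b (\<lambda>y. F y \<bullet> b) x)"

definition Lp_space :: "ereal \<Rightarrow> 'a::euclidean_space set \<Rightarrow> ('a \<Rightarrow> real) set" where
  "Lp_space p \<Omega> = {f \<in> borel_measurable (lebesgue_on \<Omega>).
     if p = \<infinity> then esssup (lebesgue_on \<Omega>) (\<lambda>x. ereal \<bar>f x\<bar>) < \<infinity>
     else integrable (lebesgue_on \<Omega>) (\<lambda>x. \<bar>f x\<bar> powr real_of_ereal p)}"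

primrec sobolev :: "nat \<Rightarrow> ereal \<Rightarrow> 'a::euclidean_space set \<Rightarrow> ('a \<Rightarrow> real) set" where
  "sobolev 0 p \<Omega> = Lp_space p \<Omega>"
| "sobolev (Suc k) p \<Omega> =
     {u \<in> Lp_space p \<Omega>. \<forall>b\<in>Basis. \<exists>v \<in> sobolev k p \<Omega>. has_weak_partial \<Omega> b u v}"

definition grad_sup_norm :: "'a::euclidean_space set \<Rightarrow> ('a \<Rightarrow> real) \<Rightarrow> ereal" where
  "grad_sup_norm \<Omega> u = esssup (lebesgue_on \<Omega>) (\<lambda>x. ereal (norm (weak_grad \<Omega> u x)))"


section \<open>The nonlinearity\<close>

definition caratheodory :: "'a::euclidean_space set \<Rightarrow> ('a \<Rightarrow> real \<Rightarrow> real) \<Rightarrow> bool" where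
  "caratheodory \<Omega> h \<longleftrightarrow> (\<forall>s. (\<lambda>x. h x s) \<in> borel_measurable (lebesgue_on \<Omega>)) \<and>
     (AE x in lebesgue_on \<Omega>. continuous_on UNIV (h x))"

definition hyp_h1 :: "'a::euclidean_space set \<Rightarrow> ('a \<Rightarrow> real \<Rightarrow> real) \<Rightarrow> bool" where
  "hyp_h1 \<Omega> h \<longleftrightarrow> caratheodory \<Omega> h \<and>
     (\<forall>\<rho>>0. \<exists>\<alpha>\<in>Lp_space \<infinity> \<Omega>. AE x in lebesgue_on \<Omega>. \<forall>s. \<bar>s\<bar> \<le> \<rho> \<longrightarrow> \<bar>h x s\<bar> \<le> \<alpha> x)"

definition primitive :: "('a \<Rightarrow> real \<Rightarrow> real) \<Rightarrow> 'a \<Rightarrow> real \<Rightarrow> real" where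
  "primitive h x s = (LBINT \<tau>=ereal 0..ereal s. h x \<tau>)"


section \<open>Solutions and the energy functional\<close>

text \<open>
  Boundary values refer to the representative that is continuous up to the boundary: it exists for
  the Sobolev functions below, and continuity on the closure selects it.
\<close>

definition K0 :: "'a::euclidean_space set \<Rightarrow> ('a \<Rightarrow> real) set" where
  "K0 \<Omega> = {u \<in> sobolev 1 \<infinity> \<Omega>. continuous_on (closure \<Omega>) u \<and>
     grad_sup_norm \<Omega> u \<le> 1 \<and> (\<forall>x\<in>frontier \<Omega>. u x = 0)}"

definition is_solution ::
    "'a::euclidean_space set \<Rightarrow> ('a \<Rightarrow> real \<Rightarrow> real) \<Rightarrow> real \<Rightarrow> real \<Rightarrow> ('a \<Rightarrow> real) \<Rightarrow> bool" where
  "is_solution \<Omega> h lam \<mu> u \<longleftrightarrow>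
     (\<exists>q>real DIM('a). u \<in> sobolev 2 (ereal q) \<Omega>) \<and>
     continuous_on (closure \<Omega>) u \<and>
     grad_sup_norm \<Omega> u < 1 \<and>
     (AE x in lebesgue_on \<Omega>.
        - weak_div \<Omega> (\<lambda>y. weak_grad \<Omega> u y /\<^sub>R sqrt (1 - (norm (weak_grad \<Omega> u y))\<^sup>2)) x
          = lam * u x + \<mu> * h x (u x)) \<and>
     (\<forall>x\<in>frontier \<Omega>. u x = 0)"

definition Psi :: "'a::euclidean_space set \<Rightarrow> ('a \<Rightarrow> real) \<Rightarrow> ereal" where
  "Psi \<Omega> u = (if u \<in> K0 \<Omega>
     then ereal (LINT x|lebesgue_on \<Omega>. 1 - sqrt (1 - (norm (weak_grad \<Omega> u x))\<^sup>2))
     else \<infinity>)"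

definition potential :: "'a::euclidean_space set \<Rightarrow> ('a \<Rightarrow> real \<Rightarrow> real) \<Rightarrow> ('a \<Rightarrow> real) \<Rightarrow> real" where
  "potential \<Omega> h u = (LINT x|lebesgue_on \<Omega>. primitive h x (u x))"

definition energy ::
    "'a::euclidean_space set \<Rightarrow> ('a \<Rightarrow> real \<Rightarrow> real) \<Rightarrow> real \<Rightarrow> real \<Rightarrow> ('a \<Rightarrow> real) \<Rightarrow> ereal" where
  "energy \<Omega> h lam \<mu> u =
     Psi \<Omega> u - ereal (lam / 2 * (LINT x|lebesgue_on \<Omega>. (u x)\<^sup>2)) - ereal (\<mu> * potential \<Omega> h u)"

definition inf_energy ::
    "'a::euclidean_space set \<Rightarrow> ('a \<Rightarrow> real \<Rightarrow> real) \<Rightarrow> real \<Rightarrow> real \<Rightarrow> ereal" where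
  "inf_energy \<Omega> h lam \<mu> = (INF v\<in>{v. continuous_on (closure \<Omega>) v}. energy \<Omega> h lam \<mu> v)"

text \<open>
  Since \<open>m\<close> tends to infinity, at most finitely many of the functions \<open>u (m n)\<close> have a
  parameter outside a given half-line on which the family \<open>u\<close> is specified; they do not
  matter for the existence of a convergent subsequence.
\<close>

definition subconverges_to_maximizer ::
    "'a::euclidean_space set \<Rightarrow> ('a \<Rightarrow> real \<Rightarrow> real) \<Rightarrow> (real \<Rightarrow> 'a \<Rightarrow> real) \<Rightarrow> bool" where
  "subconverges_to_maximizer \<Omega> h u \<longleftrightarrow>
     (\<forall>m :: nat \<Rightarrow> real. filterlim m at_top sequentially \<longrightarrow>
        (\<exists>r u_inf. strict_mono (r :: nat \<Rightarrow> nat) \<and>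
           uniform_limit (closure \<Omega>) (\<lambda>n. u (m (r n))) u_inf sequentially \<and>
           is_arg_max (potential \<Omega> h) (\<lambda>v. v \<in> K0 \<Omega>) u_inf))"

end

theory Submission
  imports Defs "HOL-Complex_Analysis.Great_Picard"
begin

text \<open>
  All members of \<open>K0 \<Omega>\<close> share one Lipschitz constant and one bound, and \<open>K0 \<Omega>\<close> is closed under
  uniform convergence; so it is compact in the uniform topology. On \<open>K0 \<Omega>\<close> the part \<open>Psi\<close> of the
  energy lies between \<open>0\<close> and the volume of the domain, and the quadratic part is bounded. Comparing
  a minimizer \<open>u\<close> for the parameter \<open>\<mu>\<close> with a fixed competitor \<open>v\<close> and dividing by \<open>\<mu>\<close> therefore
  gives \<open>potential v \<le> potential u + C / \<mu>\<close> (\<open>minimizer_potential_bound\<close>). The potential is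
  continuous under bounded pointwise convergence (\<open>potential_tendsto\<close>), so a uniform limit of
  minimizers, which exists along a subsequence by the theorem of Arzela and Ascoli, maximizes it.

  Two facts about Sobolev functions carry the argument.

  Equicontinuity (\<open>K0_zero_extension_lipschitz\<close>): averaging against a smooth bump that moves along a
  segment in the domain shows that a weak gradient bounded by one makes the function 1-Lipschitz on
  the segment. A segment leaving the domain is cut at the boundary, where the function vanishes.

  Closedness (\<open>K0_uniform_limit\<close>): the limit needs a weak gradient bounded by one. The weak
  gradients bounded by one of functions close to the limit form decreasing convex sets of fields;
  almost minimal elements for the \<open>L\<^sup>2\<close> norm in these sets converge strongly by the parallelogram law
  (\<open>midpoint_convex_AE_convergent_selection\<close>), and their limit is the gradient sought.
\<close>

section \<open>Smooth bump functions\<close>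

lemma Ck_on_SucI:
  fixes f :: "'a::euclidean_space \<Rightarrow> real"
  assumes "\<And>x. (f has_derivative f' x) (at x)"
    and "\<And>b. b \<in> Basis \<Longrightarrow> Ck_on k UNIV (\<lambda>x. f' x b)"
  shows "Ck_on (Suc k) UNIV f"
proof -
  have "frechet_derivative f (at x) = f' x" for x
    using frechet_derivative_at[OF assms(1)] by simp
  then show ?thesis
    using assms by (auto simp: differentiable_on_def differentiable_def)
qed

lemma Ck_on_SucD:
  fixes f :: "'a::euclidean_space \<Rightarrow> real"
  shows "Ck_on (Suc k) UNIV f \<Longrightarrow> Ck_on k UNIV f"
proof (induction k arbitrary: f)
  case 0
  then show ?case by (simp add: differentiable_imp_continuous_on)
next
  case (Suc k)
  have "f differentiable_on UNIV"
    and "\<forall>b\<in>Basis. Ck_on (Suc k) UNIV (\<lambda>x. frechet_derivative f (at x) b)"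
    using Suc.prems by (auto simp only: Ck_on.simps)
  then show ?case using Suc.IH by (simp del: Ck_on.simps add: Ck_on.simps(2)[of k UNIV f])
qed

lemma Ck_on_has_derivative:
  fixes f :: "'a::euclidean_space \<Rightarrow> real"
  assumes "Ck_on (Suc k) UNIV f"
  shows "(f has_derivative frechet_derivative f (at x)) (at x)"
  using assms by (auto simp: differentiable_on_def frechet_derivative_works[symmetric])

lemma Ck_on_const: "Ck_on k UNIV (\<lambda>x::'a::euclidean_space. c)"
proof (induction k arbitrary: c)
  case (Suc k)
  show ?case by (rule Ck_on_SucI[where f' = "\<lambda>_ _. 0"]) (auto intro: Suc)
qed simp

lemma Ck_on_add:
  fixes f g :: "'a::euclidean_space \<Rightarrow> real"
  shows "Ck_on k UNIV f \<Longrightarrow> Ck_on k UNIV g \<Longrightarrow> Ck_on k UNIV (\<lambda>x. f x + g x)"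
proof (induction k arbitrary: f g)
  case 0
  then show ?case by (auto intro: continuous_intros)
next
  case (Suc k)
  show ?case
    by (rule Ck_on_SucI[where
          f' = "\<lambda>x b. frechet_derivative f (at x) b + frechet_derivative g (at x) b"])
      (use Suc in \<open>auto intro!: has_derivative_add Ck_on_has_derivative[of k] Suc.IH\<close>)
qed

lemma Ck_on_mult:
  fixes f g :: "'a::euclidean_space \<Rightarrow> real"
  shows "Ck_on k UNIV f \<Longrightarrow> Ck_on k UNIV g \<Longrightarrow> Ck_on k UNIV (\<lambda>x. f x * g x)"
proof (induction k arbitrary: f g)
  case 0
  then show ?case by (auto intro: continuous_intros)
next
  case (Suc k)
  show ?case
  proof (rule Ck_on_SucI[where
          f' = "\<lambda>x b. f x * frechet_derivative g (at x) b + frechet_derivative f (at x) b * g x"])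
    show "Ck_on k UNIV (\<lambda>x. f x * frechet_derivative g (at x) b
            + frechet_derivative f (at x) b * g x)"
      if "b \<in> Basis" for b
      using Suc.prems Suc.prems[THEN Ck_on_SucD] that by (auto intro!: Ck_on_add Suc.IH)
  qed (intro has_derivative_mult Ck_on_has_derivative[OF Suc.prems(1)]
        Ck_on_has_derivative[OF Suc.prems(2)])
qed

lemma Ck_on_prod:
  fixes f :: "'i \<Rightarrow> 'a::euclidean_space \<Rightarrow> real"
  assumes "\<And>i. i \<in> I \<Longrightarrow> Ck_on k UNIV (f i)"
  shows "Ck_on k UNIV (\<lambda>x. \<Prod>i\<in>I. f i x)"
  using assms
  by (induction I rule: infinite_finite_induct) (auto intro: Ck_on_const Ck_on_mult)

text \<open>
  The classical function \<open>exp (-1/t)\<close>, flat at the origin. Division by the powers of \<open>t\<close> is included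
  because these functions are closed under differentiation up to linear combinations, which makes
  smoothness a single induction.
\<close>

definition flat :: "nat \<Rightarrow> real \<Rightarrow> real" where
  "flat k t = (if t > 0 then exp (- (1 / t)) / t ^ k else 0)"

lemma power_div_fact_le_exp:
  assumes "0 \<le> (y::real)"
  shows "y ^ n / fact n \<le> exp y"
proof -
  have s: "(\<lambda>n. y ^ n / fact n) sums exp y"
    using exp_converges[of y] by (simp add: divide_inverse mult.commute)
  have "sum (\<lambda>n. y ^ n / fact n) {n} \<le> (\<Sum>n. y ^ n / fact n)"
    by (rule sum_le_suminf) (use assms s sums_summable in auto)
  then show ?thesis using sums_unique[OF s] by simp
qed

text \<open>The quadratic bound at the origin gives differentiability there, with derivative zero.\<close>

lemma flat_le_square: "\<bar>flat k t\<bar> \<le> fact (k + 2) * t\<^sup>2"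
proof (cases "t > 0")
  case True
  have "(1/t) ^ (k+2) / fact (k+2) \<le> exp (1/t)"
    by (rule power_div_fact_le_exp) (use True in auto)
  then have "(1/t) ^ (k+2) \<le> fact (k+2) * exp (1/t)"
    by (simp only: pos_divide_le_eq[of "fact (k+2)" "(1/t) ^ (k+2)"] fact_gt_zero mult.commute)
  then have "(1/t) ^ (k+2) * exp (- (1/t)) \<le> fact (k+2)"
    by (simp only: exp_minus pos_divide_le_eq[symmetric] exp_gt_zero divide_inverse[symmetric])
  then have "(1/t) ^ (k+2) * exp (- (1/t)) * t\<^sup>2 \<le> fact (k+2) * t\<^sup>2"
    by (rule mult_right_mono) simp
  moreover have "(1/t) ^ (k+2) * exp (- (1/t)) * t\<^sup>2 = flat k t"
    using True by (simp add: flat_def power_add power_one_over power2_eq_square)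
  ultimately show ?thesis using True by (simp add: flat_def)
qed (auto simp: flat_def)

lemma has_real_derivative_flat:
  "(flat k has_real_derivative (flat (k + 2) t - k * flat (k + 1) t)) (at t)"
proof -
  consider "t > 0" | "t < 0" | "t = 0" by linarith
  then show ?thesis
  proof cases
    case 1
    have "((\<lambda>t. exp (- (1 / t)) / t ^ k) has_real_derivative (flat (k + 2) t - k * flat (k + 1) t))
        (at t)"
    proof (cases k)
      case 0
      then show ?thesis
        using 1 by (auto intro!: derivative_eq_intros simp: flat_def field_simps power2_eq_square)
    next
      case (Suc j)
      then show ?thesis
        using 1 by (auto intro!: derivative_eq_intros simp: flat_def field_simps power2_eq_square)
          (cases j; simp)
    qed
    then show ?thesis
      by (rule has_field_derivative_transform_within_open[where S = "{0<..}"])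
        (use 1 in \<open>auto simp: flat_def\<close>)
  next
    case 2
    have "((\<lambda>t. 0) has_real_derivative (flat (k + 2) t - k * flat (k + 1) t)) (at t)"
      using 2 by (simp add: flat_def)
    then show ?thesis
      by (rule has_field_derivative_transform_within_open[where S = "{..<0}"])
        (use 2 in \<open>auto simp: flat_def\<close>)
  next
    case 3
    have "((\<lambda>h. flat k h / h) \<longlongrightarrow> 0) (at 0)"
    proof (rule tendsto_rabs_zero_cancel,
        rule tendsto_sandwich[where f = "\<lambda>_. 0" and h = "\<lambda>h. fact (k + 2) * \<bar>h\<bar>"])
      show "\<forall>\<^sub>F h in at 0. \<bar>flat k h / h\<bar> \<le> fact (k + 2) * \<bar>h\<bar>"
      proof (rule eventually_at_filter[THEN iffD2], intro always_eventually allI impI)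
        fix h :: real assume "h \<noteq> 0"
        then show "\<bar>flat k h / h\<bar> \<le> fact (k + 2) * \<bar>h\<bar>"
          using flat_le_square[of k h]
          by (simp add: divide_le_eq mult.assoc abs_mult_self_eq power2_eq_square)
      qed
      show "((\<lambda>h. fact (k + 2) * \<bar>h\<bar>) \<longlongrightarrow> 0) (at (0::real))"
        by (auto intro!: tendsto_eq_intros)
    qed auto
    then show ?thesis using 3 by (simp add: DERIV_def flat_def)
  qed
qed

lemma Ck_on_flat: "Ck_on j UNIV (\<lambda>x::'a::euclidean_space. flat k (x \<bullet> v + c))"
proof (induction j arbitrary: k)
  case 0
  have "continuous_on UNIV (flat k)"
    using has_real_derivative_flat by (metis DERIV_isCont continuous_at_imp_continuous_on)
  then show ?case
    by (auto intro!: continuous_intros continuous_on_compose2[where g = "flat k" and t = UNIV])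
next
  case (Suc j)
  show ?case
  proof (rule Ck_on_SucI[where
        f' = "\<lambda>x b. (b \<bullet> v) * (flat (k + 2) (x \<bullet> v + c) + (- real k) * flat (k + 1) (x \<bullet> v + c))"])
    fix x
    have "((\<lambda>x. x \<bullet> v + c) has_derivative (\<lambda>b. b \<bullet> v)) (at x)"
      by (auto intro!: derivative_eq_intros)
    from has_derivative_compose[OF this has_real_derivative_flat[THEN has_field_derivative_imp_has_derivative]]
    show "((\<lambda>x. flat k (x \<bullet> v + c)) has_derivative
       (\<lambda>b. (b \<bullet> v) * (flat (k + 2) (x \<bullet> v + c) + (- real k) * flat (k + 1) (x \<bullet> v + c)))) (at x)"
      by (simp add: mult.commute)
  qed (intro Ck_on_mult Ck_on_add Ck_on_const Suc)
qed

lemma flat_0_range: "0 \<le> flat 0 t" "flat 0 t \<le> 1"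
  by (auto simp: flat_def)

text \<open>The parameter \<open>n\<close> sharpens the edges: the bumps increase to the indicator of the box.\<close>

definition bump :: "real \<Rightarrow> 'a::euclidean_space \<Rightarrow> 'a \<Rightarrow> 'a \<Rightarrow> real" where
  "bump n a b x = (\<Prod>i\<in>Basis. flat 0 (n * ((x - a) \<bullet> i)) * flat 0 (n * ((b - x) \<bullet> i)))"

lemma Ck_on_bump: "Ck_on k UNIV (bump n a b)"
proof -
  have "Ck_on k UNIV (\<lambda>x. flat 0 (x \<bullet> (n *\<^sub>R i) + - n * (a \<bullet> i)) *
      flat 0 (x \<bullet> (- n *\<^sub>R i) + n * (b \<bullet> i)))" for i
    by (intro Ck_on_mult Ck_on_flat)
  moreover have "flat 0 (n * ((x - a) \<bullet> i)) * flat 0 (n * ((b - x) \<bullet> i)) =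
      flat 0 (x \<bullet> (n *\<^sub>R i) + - n * (a \<bullet> i)) * flat 0 (x \<bullet> (- n *\<^sub>R i) + n * (b \<bullet> i))" for x i
    by (simp add: algebra_simps)
  ultimately have "Ck_on k UNIV (\<lambda>x. \<Prod>i\<in>Basis. flat 0 (n * ((x - a) \<bullet> i)) * flat 0 (n * ((b - x) \<bullet> i)))"
    by (intro Ck_on_prod) simp
  then show ?thesis by (simp add: bump_def[abs_def])
qed

lemma continuous_bump: "continuous_on S (bump n a b)"
  using Ck_on_bump[of 0 n a b] continuous_on_subset by auto

lemma bump_range: "0 \<le> bump n a b x" "bump n a b x \<le> 1"
  unfolding bump_def by (auto intro!: prod_nonneg prod_le_1 mult_le_one simp: flat_0_range)

lemma bump_pos_iff:
  assumes "n > 0"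
  shows "bump n a b x > 0 \<longleftrightarrow> x \<in> box a b"
proof
  assume "x \<in> box a b"
  then show "bump n a b x > 0" unfolding bump_def
    by (intro prod_pos) (use assms in \<open>auto simp: flat_def mem_box inner_diff_left\<close>)
next
  assume *: "bump n a b x > 0"
  show "x \<in> box a b"
  proof (rule ccontr)
    assume "x \<notin> box a b"
    then obtain i where "i \<in> Basis" "\<not> (a \<bullet> i < x \<bullet> i \<and> x \<bullet> i < b \<bullet> i)"
      by (auto simp: mem_box)
    moreover from this have "flat 0 (n * ((x - a) \<bullet> i)) * flat 0 (n * ((b - x) \<bullet> i)) = 0"
      using assms by (auto simp: flat_def inner_diff_left zero_less_mult_iff)
    ultimately have "bump n a b x = 0" unfolding bump_def
      by (intro prod_zero) auto
    then show False using * by simp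
  qed
qed

lemma bump_eq_0: "n > 0 \<Longrightarrow> x \<notin> box a b \<Longrightarrow> bump n a b x = 0"
  using bump_pos_iff[of n a b x] bump_range(1)[of n a b x] by linarith

lemma bump_translate: "bump n (a + p) (b + p) x = bump n a b (x - p)"
  unfolding bump_def by (simp add: algebra_simps)

lemma bump_tendsto_indicator:
  "(\<lambda>m. bump (real (Suc m)) a b x) \<longlonglongrightarrow> indicator (box a b) x"
proof (cases "x \<in> box a b")
  case True
  have flat: "(\<lambda>m. flat 0 (real (Suc m) * t)) \<longlonglongrightarrow> 1" if "t > 0" for t
  proof -
    have "filterlim (\<lambda>m. real (Suc m) * t) at_top sequentially"
      by (intro filterlim_at_top_mult_tendsto_pos[OF tendsto_const that]
          filterlim_compose[OF filterlim_real_sequentially filterlim_Suc])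
    then have "(\<lambda>m. - (1 / (real (Suc m) * t))) \<longlonglongrightarrow> - 0"
      by (intro tendsto_minus tendsto_divide_0[OF tendsto_const] filterlim_at_top_imp_at_infinity)
    then have "(\<lambda>m. exp (- (1 / (real (Suc m) * t)))) \<longlonglongrightarrow> exp (- 0)"
      by (rule tendsto_exp)
    then show ?thesis using that by (simp add: flat_def)
  qed
  have "(\<lambda>m. bump (real (Suc m)) a b x) \<longlonglongrightarrow> (\<Prod>i\<in>(Basis::'a set). 1 * 1)"
    unfolding bump_def
    by (intro tendsto_prod tendsto_mult flat) (use True in \<open>auto simp: mem_box inner_diff_left\<close>)
  then show ?thesis using True by simp
next
  case False
  then have "bump (real (Suc m)) a b x = 0" for m by (intro bump_eq_0) auto
  then show ?thesis using False by simp
qed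

lemma test_function_bump:
  assumes "n > 0" "cbox a b \<subseteq> \<Omega>"
  shows "test_function \<Omega> (bump n a b)"
proof -
  have "{x. bump n a b x \<noteq> 0} \<subseteq> cbox a b"
    using bump_eq_0[OF assms(1)] box_subset_cbox by blast
  then have "closure {x. bump n a b x \<noteq> 0} \<subseteq> cbox a b"
    by (simp add: closure_minimal closed_cbox)
  moreover from this have "compact (closure {x. bump n a b x \<noteq> 0})"
    using compact_Int_closed[OF compact_cbox closed_closure] by (metis inf.absorb2)
  ultimately show ?thesis
    unfolding test_function_def using Ck_on_bump assms(2) by blast
qed

section \<open>Weak gradients\<close>

lemma locally_integrable_imp_measurable:
  fixes v :: "'a::euclidean_space \<Rightarrow> real"
  assumes "open \<Omega>" "locally_integrable \<Omega> v"
  shows "v \<in> borel_measurable (lebesgue_on \<Omega>)"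
proof -
  obtain C :: "nat \<Rightarrow> 'a set" where C: "\<And>n. compact (C n)" "\<And>n. C n \<subseteq> \<Omega>"
    "\<And>n. C n \<subseteq> interior (C (Suc n))" "\<Union> (range C) = \<Omega>"
    using open_Union_compact_subsets[OF assms(1)] by metis
  have mono: "C m \<subseteq> C n" if "m \<le> n" for m n
    using lift_Suc_mono_le[of C, OF _ that] C(3) interior_subset by blast
  show ?thesis
  proof (rule borel_measurable_LIMSEQ_real[where u = "\<lambda>n x. indicator (C n) x * v x"])
    fix n
    have "set_integrable lebesgue (C n) v"
      using assms(2) C(1,2) unfolding locally_integrable_def by blast
    then have "(\<lambda>x. indicator (C n) x * v x) \<in> borel_measurable lebesgue"
      by (auto simp: set_integrable_def dest: borel_measurable_integrable)
    then show "(\<lambda>x. indicator (C n) x * v x) \<in> borel_measurable (lebesgue_on \<Omega>)"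
      by (rule measurable_restrict_space1)
  next
    fix x assume "x \<in> space (lebesgue_on \<Omega>)"
    then obtain N where "x \<in> C N" using C(4) by auto
    then have "x \<in> C n" if "n \<ge> N" for n using mono[OF that] by blast
    then have "\<forall>\<^sub>F n in sequentially. indicator (C n) x * v x = v x"
      by (auto simp: eventually_sequentially intro!: exI[of _ N])
    then show "(\<lambda>n. indicator (C n) x * v x) \<longlonglongrightarrow> v x" by (rule tendsto_eventually)
  qed
qed

lemma locally_integrable_linear:
  assumes "locally_integrable \<Omega> u" "locally_integrable \<Omega> v"
  shows "locally_integrable \<Omega> (\<lambda>x. a * u x + b * v x)"
  unfolding locally_integrable_def
proof (intro allI impI)
  fix K assume "compact K \<and> K \<subseteq> \<Omega>"
  then have "u absolutely_integrable_on K" "v absolutely_integrable_on K"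
    using assms by (auto simp: locally_integrable_def)
  then have "(\<lambda>x. a * u x) absolutely_integrable_on K" "(\<lambda>x. b * v x) absolutely_integrable_on K"
    by simp_all
  then show "(\<lambda>x. a * u x + b * v x) absolutely_integrable_on K" by (rule set_integral_add(1))
qed

lemma locally_integrable_continuous:
  fixes u :: "'a::euclidean_space \<Rightarrow> real"
  assumes "continuous_on \<Omega> u"
  shows "locally_integrable \<Omega> u"
  unfolding locally_integrable_def
proof (intro allI impI, elim conjE)
  fix K assume K: "compact K" "K \<subseteq> \<Omega>"
  have "integrable lborel (\<lambda>x. indicator K x *\<^sub>R u x)"
    by (rule borel_integrable_compact) (use K assms continuous_on_subset in auto)
  then show "u absolutely_integrable_on K"
    by (simp add: set_integrable_def integrable_completion borel_measurable_integrable)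
qed

lemma locally_integrable_bounded:
  fixes v :: "'a::euclidean_space \<Rightarrow> real"
  assumes "open \<Omega>" "v \<in> borel_measurable (lebesgue_on \<Omega>)"
    and "AE x in lebesgue_on \<Omega>. \<bar>v x\<bar> \<le> B"
  shows "locally_integrable \<Omega> v"
  unfolding locally_integrable_def
proof (intro allI impI, elim conjE)
  fix K assume K: "compact K" "K \<subseteq> \<Omega>"
  have meas: "(\<lambda>x. indicator \<Omega> x *\<^sub>R v x) \<in> borel_measurable lebesgue"
    using assms(1,2) by (simp add: borel_measurable_restrict_space_iff)
  have [measurable]: "K \<in> sets lebesgue" using K(1) by (simp add: compact_imp_closed)
  have "integrable lebesgue (\<lambda>x. indicator K x *\<^sub>R (indicator \<Omega> x *\<^sub>R v x))"
  proof (rule Bochner_Integration.integrable_bound)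
    show "integrable lebesgue (\<lambda>x. indicator K x *\<^sub>R B)"
      using lmeasurable_compact[OF K(1)]
      by (intro integrable_scaleR_left integrable_real_indicator) (auto simp: fmeasurable_def)
    have "AE x in lebesgue. x \<in> \<Omega> \<longrightarrow> \<bar>v x\<bar> \<le> B"
      using assms(1,3) by (simp add: AE_restrict_space_iff)
    then show "AE x in lebesgue. norm (indicator K x *\<^sub>R (indicator \<Omega> x *\<^sub>R v x))
        \<le> norm (indicator K x *\<^sub>R B)"
      by eventually_elim (auto simp: indicator_def)
  qed (use meas in measurable)
  moreover have "indicator K x *\<^sub>R (indicator \<Omega> x *\<^sub>R v x) = indicator K x *\<^sub>R v x" for x
    using K(2) by (auto simp: indicator_def)
  ultimately show "v absolutely_integrable_on K" by (simp only: set_integrable_def)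
qed

lemma integrable_mult_compact_support:
  fixes v \<psi> :: "'a::euclidean_space \<Rightarrow> real"
  assumes "open \<Omega>" "locally_integrable \<Omega> v"
    and K: "compact K" "K \<subseteq> \<Omega>" "continuous_on UNIV \<psi>" "\<And>x. x \<notin> K \<Longrightarrow> \<psi> x = 0"
  shows "integrable (lebesgue_on \<Omega>) (\<lambda>x. v x * \<psi> x)"
proof -
  have int: "integrable lebesgue (\<lambda>x. indicator K x * v x)"
    using assms(2) K(1,2) by (auto simp: locally_integrable_def set_integrable_def)
  obtain B where B: "\<And>x. x \<in> K \<Longrightarrow> \<bar>\<psi> x\<bar> \<le> B"
    using compact_imp_bounded[OF compact_continuous_image[OF continuous_on_subset[OF K(3)] K(1)]]
    by (auto simp: bounded_iff)
  have "integrable lebesgue (\<lambda>x. indicator K x * v x * \<psi> x)"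
  proof (rule Bochner_Integration.integrable_bound)
    show "integrable lebesgue (\<lambda>x. B * (indicator K x * v x))" using int by simp
    have "\<psi> \<in> borel_measurable lebesgue"
      using K(3) by (simp add: borel_measurable_continuous_onI measurable_completion)
    then show "(\<lambda>x. indicator K x * v x * \<psi> x) \<in> borel_measurable lebesgue"
      using borel_measurable_integrable[OF int] by measurable
    show "AE x in lebesgue. norm (indicator K x * v x * \<psi> x) \<le> norm (B * (indicator K x * v x))"
    proof (intro AE_I2)
      fix x
      show "norm (indicator K x * v x * \<psi> x) \<le> norm (B * (indicator K x * v x))"
      proof (cases "x \<in> K")
        case True
        then have "\<bar>\<psi> x\<bar> \<le> \<bar>B\<bar>" using B by force
        then show ?thesis using True
          by (simp add: abs_mult mult.commute mult_right_mono)
      qed simp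
    qed
  qed
  moreover have "indicator K x * v x * \<psi> x = indicator \<Omega> x *\<^sub>R (v x * \<psi> x)" for x
    using K(2,4) by (auto simp: indicator_def)
  ultimately show ?thesis using assms(1) by (simp add: integrable_restrict_space)
qed

text \<open>A compact set outside which a test function and its derivative vanish; all integrals in the
  definition of weak derivatives live there.\<close>

lemma test_function_support:
  fixes \<phi> :: "'a::euclidean_space \<Rightarrow> real"
  assumes "test_function \<Omega> \<phi>"
  obtains K where "compact K" "K \<subseteq> \<Omega>" "continuous_on UNIV \<phi>" "\<And>x. x \<notin> K \<Longrightarrow> \<phi> x = 0"
    "\<And>b. b \<in> Basis \<Longrightarrow> continuous_on UNIV (\<lambda>x. frechet_derivative \<phi> (at x) b)"
    "\<And>x b. x \<notin> K \<Longrightarrow> frechet_derivative \<phi> (at x) b = 0"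
    "\<And>x. (\<phi> has_derivative frechet_derivative \<phi> (at x)) (at x)"
proof
  let ?K = "closure {x. \<phi> x \<noteq> 0}"
  have Ck: "Ck_on k UNIV \<phi>" for k using assms by (simp add: test_function_def)
  show "compact ?K" "?K \<subseteq> \<Omega>" using assms by (auto simp: test_function_def)
  show "continuous_on UNIV \<phi>" using Ck[of 0] by simp
  show zero: "\<phi> x = 0" if "x \<notin> ?K" for x using that closure_subset[of "{x. \<phi> x \<noteq> 0}"] by blast
  show "continuous_on UNIV (\<lambda>x. frechet_derivative \<phi> (at x) b)" if "b \<in> Basis" for b
    using Ck[of "Suc 0"] that by simp
  show "(\<phi> has_derivative frechet_derivative \<phi> (at x)) (at x)" for x
    using Ck_on_has_derivative[OF Ck] .
  show "frechet_derivative \<phi> (at x) b = 0" if "x \<notin> ?K" for x b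
  proof -
    have "((\<lambda>_. 0) has_derivative (\<lambda>_. 0)) (at x)" by simp
    then have "(\<phi> has_derivative (\<lambda>_. 0)) (at x)"
      by (rule has_derivative_transform_within_open[where s = "- ?K"])
        (use that zero[symmetric] in \<open>auto simp only: open_Compl closed_closure Compl_iff\<close>)
    from frechet_derivative_at[OF this] show ?thesis by (metis (no_types))
  qed
qed

lemma cube_subset_cball:
  fixes x :: "'a::euclidean_space"
  assumes "0 \<le> h" "real DIM('a) * h \<le> e"
  shows "cbox (x - h *\<^sub>R One) (x + h *\<^sub>R One) \<subseteq> cball x e"
proof
  fix y assume y: "y \<in> cbox (x - h *\<^sub>R One) (x + h *\<^sub>R One)"
  have "norm (y - x) \<le> (\<Sum>i\<in>Basis. \<bar>(y - x) \<bullet> i\<bar>)" by (rule norm_le_l1)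
  also have "\<dots> \<le> (\<Sum>i\<in>(Basis::'a set). h)"
    using y by (intro sum_mono) (force simp: mem_box algebra_simps abs_le_iff)
  finally show "y \<in> cball x e" using assms by (simp add: dist_norm norm_minus_commute)
qed

text \<open>
  The fundamental lemma of the calculus of variations: testing against bumps and sharpening their
  edges shows that all integrals over boxes vanish, and almost every value of \<open>v\<close> is a limit of
  averages over shrinking cubes.
\<close>

lemma AE_zero_if_test_integrals_zero:
  fixes v :: "'a::euclidean_space \<Rightarrow> real"
  assumes "open \<Omega>" and loc: "locally_integrable \<Omega> v"
    and test: "\<And>\<phi>. test_function \<Omega> \<phi> \<Longrightarrow> (LINT x|lebesgue_on \<Omega>. v x * \<phi> x) = 0"
  shows "AE x in lebesgue_on \<Omega>. v x = 0"
proof -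
  have box0: "integral (cbox a b) v = 0" if sub: "cbox a b \<subseteq> \<Omega>" for a b
  proof -
    let ?w = "\<lambda>x. indicator (cbox a b) x * v x"
    have int: "integrable lebesgue ?w"
      using loc sub by (auto simp: locally_integrable_def set_integrable_def)
    have [measurable]: "bump n a b \<in> borel_measurable lebesgue" for n
      by (simp add: borel_measurable_continuous_onI measurable_completion continuous_bump)
    note [measurable] = borel_measurable_integrable[OF int]
    have "(LINT x|lebesgue. ?w x * bump (real (Suc m)) a b x) = 0" for m
    proof -
      have "indicator \<Omega> x *\<^sub>R (v x * bump (real (Suc m)) a b x) = ?w x * bump (real (Suc m)) a b x" for x
        using sub bump_eq_0[of "real (Suc m)" x a b] box_subset_cbox[of a b]
        by (auto simp: indicator_def)
      moreover have "(LINT x|lebesgue_on \<Omega>. v x * bump (real (Suc m)) a b x)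
          = (LINT x|lebesgue. indicator \<Omega> x *\<^sub>R (v x * bump (real (Suc m)) a b x))"
        using assms(1) by (intro integral_restrict_space) simp
      ultimately show ?thesis
        using test[OF test_function_bump[OF _ sub, of "real (Suc m)"]]
        by (simp only: of_nat_0_less_iff zero_less_Suc)
    qed
    moreover have "(\<lambda>m. LINT x|lebesgue. ?w x * bump (real (Suc m)) a b x)
        \<longlonglongrightarrow> (LINT x|lebesgue. ?w x * indicator (box a b) x)"
    proof (rule integral_dominated_convergence[where w = "\<lambda>x. \<bar>?w x\<bar>"])
      show "AE x in lebesgue. (\<lambda>m. ?w x * bump (real (Suc m)) a b x)
          \<longlonglongrightarrow> ?w x * indicator (box a b) x"
        by (intro AE_I2 tendsto_intros bump_tendsto_indicator)
      show "AE x in lebesgue. norm (?w x * bump (real (Suc m)) a b x) \<le> \<bar>?w x\<bar>" for m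
        using bump_range[of "real (Suc m)" a b] 
        by (intro AE_I2) (simp add: abs_mult mult_left_le)
      show "(\<lambda>x. ?w x * indicator (box a b) x) \<in> borel_measurable lebesgue"
        by (intro borel_measurable_times borel_measurable_integrable[OF int]
            borel_measurable_indicator) simp
    qed (use int in auto)
    ultimately have 0: "(LINT x|lebesgue. ?w x * indicator (box a b) x) = 0"
      by (simp add: LIMSEQ_const_iff)
    have "v absolutely_integrable_on box a b"
      by (rule set_integrable_subset[of _ "cbox a b"])
        (use int box_subset_cbox in \<open>auto simp: set_integrable_def\<close>)
    then have "(LINT x:box a b|lebesgue. v x) = integral (box a b) v"
      by (rule set_lebesgue_integral_eq_integral(2))
    moreover have "(\<lambda>x. ?w x * indicator (box a b) x) = (\<lambda>x. indicator (box a b) x *\<^sub>R v x)"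
      using box_subset_cbox[of a b] by (auto simp: indicator_def fun_eq_iff)
    ultimately have "integral (box a b) v = 0"
      using 0 unfolding set_lebesgue_integral_def by metis
    then show ?thesis by (simp add: integral_open_interval)
  qed
  obtain C :: "nat \<Rightarrow> 'a set" where C: "\<And>n. compact (C n)" "\<And>n. C n \<subseteq> \<Omega>"
    "\<And>n. C n \<subseteq> interior (C (Suc n))" "\<Union> (range C) = \<Omega>"
    by (rule open_Union_compact_subsets[OF assms(1)]) blast
  have "\<exists>N. negligible N \<and> (\<forall>x\<in>interior (C n) - N. v x = 0)" for n
  proof -
    let ?f = "\<lambda>x. if x \<in> C n then v x else 0"
    have "v absolutely_integrable_on C n" using loc C by (auto simp: locally_integrable_def)
    then have "v integrable_on C n" by (rule set_lebesgue_integral_eq_integral(1))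
    then have "?f integrable_on UNIV" by (simp add: integrable_restrict_UNIV)
    then have int: "?f integrable_on cbox a b" for a b by (rule integrable_on_subcbox) simp
    obtain N where N: "negligible N" "\<And>x e. x \<notin> N \<Longrightarrow> 0 < e \<Longrightarrow>
        \<exists>d>0. \<forall>h. 0 < h \<and> h < d \<longrightarrow>
          norm (integral (cbox x (x + h *\<^sub>R One)) ?f /\<^sub>R h ^ DIM('a) - ?f x) < e"
      by (rule integrable_ccontinuous_explicit[of ?f, OF int]) blast
    have "v x = 0" if x: "x \<in> interior (C n)" "x \<notin> N" for x
    proof (rule ccontr)
      assume "v x \<noteq> 0"
      then obtain d where d: "d > 0" "\<And>h. 0 < h \<Longrightarrow> h < d \<Longrightarrow>
          norm (integral (cbox x (x + h *\<^sub>R One)) ?f /\<^sub>R h ^ DIM('a) - ?f x) < \<bar>v x\<bar>"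
        using N(2)[OF x(2), of "\<bar>v x\<bar>"] by auto
      obtain e where e: "e > 0" "cball x e \<subseteq> C n"
        using x(1) by (meson mem_interior_cball)
      define h where "h = min (d / 2) (e / real DIM('a))"
      have h: "0 < h" "h < d" "real DIM('a) * h \<le> e"
        using d(1) e(1) by (auto simp: h_def min_def field_simps)
      have "cbox x (x + h *\<^sub>R One) \<subseteq> cbox (x - h *\<^sub>R One) (x + h *\<^sub>R One)"
        using h(1) by (auto simp: subset_box inner_diff_left)
      then have sub: "cbox x (x + h *\<^sub>R One) \<subseteq> C n"
        using cube_subset_cball[of h e x] h e(2) by auto
      then have "integral (cbox x (x + h *\<^sub>R One)) ?f = integral (cbox x (x + h *\<^sub>R One)) v"
        by (intro integral_cong) auto
      also have "\<dots> = 0" using box0 sub C(2) by blast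
      finally show False using d(2)[OF h(1,2)] x(1) interior_subset[of "C n"] by auto
    qed
    then show ?thesis using N(1) by blast
  qed
  then obtain N where N: "\<And>n. negligible (N n)" "\<And>n x. x \<in> interior (C n) - N n \<Longrightarrow> v x = 0"
    by metis
  have "AE x in lebesgue. x \<notin> (\<Union>n. N n)"
    using negligible_countable_Union[of "range N"] N(1)
    by (intro AE_not_in) (auto simp: negligible_iff_null_sets)
  then have "AE x in lebesgue. x \<in> \<Omega> \<longrightarrow> v x = 0"
  proof eventually_elim
    case (elim x)
    then show ?case using N(2) C(3,4) by blast
  qed
  then show ?thesis using assms(1) by (simp add: AE_restrict_space_iff)
qed

text \<open>Uniqueness is what makes \<open>weak_grad\<close>, a choice, usable: it agrees almost everywhere with any
  weak gradient at hand.\<close>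

lemma has_weak_partial_unique:
  assumes "open \<Omega>" and v: "has_weak_partial \<Omega> b u v" and w: "has_weak_partial \<Omega> b u w"
  shows "AE x in lebesgue_on \<Omega>. v x = w x"
proof -
  have loc: "locally_integrable \<Omega> v" "locally_integrable \<Omega> w"
    using v w by (auto simp: has_weak_partial_def)
  have "AE x in lebesgue_on \<Omega>. 1 * v x + (- 1) * w x = 0"
  proof (rule AE_zero_if_test_integrals_zero[OF assms(1) locally_integrable_linear[OF loc]])
    fix \<phi> assume \<phi>: "test_function \<Omega> \<phi>"
    obtain K where K: "compact K" "K \<subseteq> \<Omega>" "continuous_on UNIV \<phi>" "\<And>x. x \<notin> K \<Longrightarrow> \<phi> x = 0"
      using test_function_support[OF \<phi>] by metis
    have "(LINT x|lebesgue_on \<Omega>. v x * \<phi> x) = (LINT x|lebesgue_on \<Omega>. w x * \<phi> x)"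
      using v w \<phi> by (auto simp: has_weak_partial_def)
    then show "(LINT x|lebesgue_on \<Omega>. (1 * v x + (- 1) * w x) * \<phi> x) = 0"
      using integrable_mult_compact_support[OF assms(1) loc(1) K]
        integrable_mult_compact_support[OF assms(1) loc(2) K]
      by (simp add: left_diff_distrib)
  qed
  then show ?thesis by simp
qed

lemma has_weak_partial_linear:
  assumes "open \<Omega>" "b \<in> Basis"
    and u: "has_weak_partial \<Omega> b u v" and u': "has_weak_partial \<Omega> b u' v'"
  shows "has_weak_partial \<Omega> b (\<lambda>x. p * u x + q * u' x) (\<lambda>x. p * v x + q * v' x)"
  unfolding has_weak_partial_def
proof (intro conjI allI impI)
  have loc: "locally_integrable \<Omega> u" "locally_integrable \<Omega> u'"
    "locally_integrable \<Omega> v" "locally_integrable \<Omega> v'"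
    using u u' by (auto simp: has_weak_partial_def)
  then show "locally_integrable \<Omega> (\<lambda>x. p * u x + q * u' x)"
    "locally_integrable \<Omega> (\<lambda>x. p * v x + q * v' x)"
    by (auto intro: locally_integrable_linear)
  fix \<phi> assume \<phi>: "test_function \<Omega> \<phi>"
  obtain K where K: "compact K" "K \<subseteq> \<Omega>" "continuous_on UNIV \<phi>" "\<And>x. x \<notin> K \<Longrightarrow> \<phi> x = 0"
    "continuous_on UNIV (\<lambda>x. frechet_derivative \<phi> (at x) b)"
    "\<And>x. x \<notin> K \<Longrightarrow> frechet_derivative \<phi> (at x) b = 0"
    using test_function_support[OF \<phi>] assms(2) by metis
  note I = integrable_mult_compact_support[OF assms(1) _ K(1,2)]
  have eq: "(LINT x|lebesgue_on \<Omega>. (p * f x + q * g x) * h x) =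
      p * (LINT x|lebesgue_on \<Omega>. f x * h x) + q * (LINT x|lebesgue_on \<Omega>. g x * h x)"
    if "integrable (lebesgue_on \<Omega>) (\<lambda>x. f x * h x)" "integrable (lebesgue_on \<Omega>) (\<lambda>x. g x * h x)"
    for f g h :: "'a \<Rightarrow> real"
    using that by (simp add: distrib_right mult.assoc)
  have "(LINT x|lebesgue_on \<Omega>. u x * frechet_derivative \<phi> (at x) b)
      = - (LINT x|lebesgue_on \<Omega>. v x * \<phi> x)"
    "(LINT x|lebesgue_on \<Omega>. u' x * frechet_derivative \<phi> (at x) b)
      = - (LINT x|lebesgue_on \<Omega>. v' x * \<phi> x)"
    using u u' \<phi> by (auto simp: has_weak_partial_def)
  then show "(LINT x|lebesgue_on \<Omega>. (p * u x + q * u' x) * frechet_derivative \<phi> (at x) b)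
      = - (LINT x|lebesgue_on \<Omega>. (p * v x + q * v' x) * \<phi> x)"
    using loc K(3-6) by (simp add: eq I)
qed

definition has_weak_grad :: "'a::euclidean_space set \<Rightarrow> ('a \<Rightarrow> real) \<Rightarrow> ('a \<Rightarrow> 'a) \<Rightarrow> bool" where
  "has_weak_grad \<Omega> u g \<longleftrightarrow> (\<forall>b\<in>Basis. has_weak_partial \<Omega> b u (\<lambda>x. g x \<bullet> b))"

lemma has_weak_grad_linear:
  assumes "open \<Omega>" "has_weak_grad \<Omega> u g" "has_weak_grad \<Omega> u' g'"
  shows "has_weak_grad \<Omega> (\<lambda>x. p * u x + q * u' x) (\<lambda>x. p *\<^sub>R g x + q *\<^sub>R g' x)"
  unfolding has_weak_grad_def
proof
  fix b :: 'a assume b: "b \<in> Basis"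
  have "has_weak_partial \<Omega> b (\<lambda>x. p * u x + q * u' x) (\<lambda>x. p * (g x \<bullet> b) + q * (g' x \<bullet> b))"
    by (rule has_weak_partial_linear[OF assms(1) b])
      (use assms(2,3) b in \<open>simp_all add: has_weak_grad_def\<close>)
  then show "has_weak_partial \<Omega> b (\<lambda>x. p * u x + q * u' x) (\<lambda>x. (p *\<^sub>R g x + q *\<^sub>R g' x) \<bullet> b)"
    by (simp add: inner_add_left)
qed

lemma has_weak_grad_measurable:
  assumes "open \<Omega>" "has_weak_grad \<Omega> u g"
  shows "g \<in> borel_measurable (lebesgue_on \<Omega>)"
proof (rule borel_measurable_euclidean_space[THEN iffD2], rule ballI)
  fix b :: 'a assume "b \<in> Basis"
  then have "locally_integrable \<Omega> (\<lambda>x. g x \<bullet> b)"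
    using assms(2) by (auto simp: has_weak_grad_def has_weak_partial_def)
  then show "(\<lambda>x. g x \<bullet> b) \<in> borel_measurable (lebesgue_on \<Omega>)"
    by (rule locally_integrable_imp_measurable[OF assms(1)])
qed

lemma has_weak_grad_weak_grad:
  assumes "\<And>b. b \<in> Basis \<Longrightarrow> \<exists>v. has_weak_partial \<Omega> b u v"
  shows "has_weak_grad \<Omega> u (weak_grad \<Omega> u)"
  unfolding has_weak_grad_def
proof
  fix b :: 'a assume b: "b \<in> Basis"
  have "(\<lambda>x. weak_grad \<Omega> u x \<bullet> b) = weak_partial \<Omega> b u"
    using b by (simp add: weak_grad_def inner_sum_left_Basis)
  then show "has_weak_partial \<Omega> b u (\<lambda>x. weak_grad \<Omega> u x \<bullet> b)"
    using someI_ex[OF assms[OF b]] by (simp add: weak_partial_def)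
qed

lemma weak_grad_AE_eq:
  assumes "open \<Omega>" "has_weak_grad \<Omega> u g"
  shows "AE x in lebesgue_on \<Omega>. weak_grad \<Omega> u x = g x"
proof -
  have "has_weak_grad \<Omega> u (weak_grad \<Omega> u)"
    by (rule has_weak_grad_weak_grad) (use assms(2) in \<open>auto simp: has_weak_grad_def\<close>)
  then have "AE x in lebesgue_on \<Omega>. \<forall>b\<in>Basis. weak_grad \<Omega> u x \<bullet> b = g x \<bullet> b"
    using assms by (intro AE_finite_allI has_weak_partial_unique) (auto simp: has_weak_grad_def)
  then show ?thesis by eventually_elim (rule euclidean_eqI, simp)
qed

text \<open>
  Weak gradients are determined up to null sets, so any representative serves to test membership.
\<close>

lemma K0_iff:
  fixes \<Omega> :: "'a::euclidean_space set"
  assumes "open \<Omega>" "bounded \<Omega>"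
  shows "u \<in> K0 \<Omega> \<longleftrightarrow> continuous_on (closure \<Omega>) u \<and> (\<forall>x\<in>frontier \<Omega>. u x = 0) \<and>
    (\<exists>g. has_weak_grad \<Omega> u g \<and> (AE x in lebesgue_on \<Omega>. norm (g x) \<le> 1))"
proof
  assume u: "u \<in> K0 \<Omega>"
  then have "has_weak_grad \<Omega> u (weak_grad \<Omega> u)"
    by (intro has_weak_grad_weak_grad) (auto simp: K0_def)
  moreover have "AE x in lebesgue_on \<Omega>. norm (weak_grad \<Omega> u x) \<le> 1"
    using esssup_AE[where M = "lebesgue_on \<Omega>" and f = "\<lambda>x. ereal (norm (weak_grad \<Omega> u x))"]
  proof eventually_elim
    case (elim x)
    moreover have "grad_sup_norm \<Omega> u \<le> 1" using u by (simp add: K0_def)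
    ultimately have "ereal (norm (weak_grad \<Omega> u x)) \<le> 1"
      unfolding grad_sup_norm_def by (rule order_trans)
    then show ?case by simp
  qed
  ultimately show "continuous_on (closure \<Omega>) u \<and> (\<forall>x\<in>frontier \<Omega>. u x = 0) \<and>
    (\<exists>g. has_weak_grad \<Omega> u g \<and> (AE x in lebesgue_on \<Omega>. norm (g x) \<le> 1))"
    using u by (auto simp: K0_def)
next
  assume r: "continuous_on (closure \<Omega>) u \<and> (\<forall>x\<in>frontier \<Omega>. u x = 0) \<and>
    (\<exists>g. has_weak_grad \<Omega> u g \<and> (AE x in lebesgue_on \<Omega>. norm (g x) \<le> 1))"
  then obtain g where g: "has_weak_grad \<Omega> u g" "AE x in lebesgue_on \<Omega>. norm (g x) \<le> 1"
    by blast
  have Linf: "f \<in> Lp_space \<infinity> \<Omega>"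
    if [measurable]: "f \<in> borel_measurable (lebesgue_on \<Omega>)" and "AE x in lebesgue_on \<Omega>. \<bar>f x\<bar> \<le> B"
    for f and B :: real
  proof -
    have "esssup (lebesgue_on \<Omega>) (\<lambda>x. ereal \<bar>f x\<bar>) \<le> ereal B"
      by (rule esssup_I) (use that in auto)
    also have "\<dots> < \<infinity>" by simp
    finally show ?thesis using that by (simp add: Lp_space_def)
  qed
  have meas: "u \<in> borel_measurable (lebesgue_on \<Omega>)"
    using r closure_subset assms(1)
    by (intro continuous_imp_measurable_on_sets_lebesgue) (auto intro: continuous_on_subset)
  have "compact (closure \<Omega>)" using assms(2) by (simp add: compact_closure)
  then have "bounded (u ` closure \<Omega>)" using r compact_continuous_image compact_imp_bounded by blast
  then obtain B where "\<And>x. x \<in> closure \<Omega> \<Longrightarrow> \<bar>u x\<bar> \<le> B" by (auto simp: bounded_iff)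
  then have "AE x in lebesgue_on \<Omega>. \<bar>u x\<bar> \<le> B"
    using closure_subset by (intro AE_I2) auto
  then have u: "u \<in> Lp_space \<infinity> \<Omega>" using Linf[OF meas] by blast
  have gm [measurable]: "g \<in> borel_measurable (lebesgue_on \<Omega>)"
    by (rule has_weak_grad_measurable[OF assms(1) g(1)])
  have gb: "(\<lambda>x. g x \<bullet> b) \<in> Lp_space \<infinity> \<Omega>" if "b \<in> Basis" for b
  proof (rule Linf)
    show "AE x in lebesgue_on \<Omega>. \<bar>g x \<bullet> b\<bar> \<le> 1"
      using g(2) by eventually_elim (use Basis_le_norm[OF that] order_trans in blast)
  qed measurable
  have wm: "weak_grad \<Omega> u \<in> borel_measurable (lebesgue_on \<Omega>)"
    by (rule has_weak_grad_measurable[OF assms(1) has_weak_grad_weak_grad])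
      (use g(1) in \<open>auto simp: has_weak_grad_def\<close>)
  have "grad_sup_norm \<Omega> u \<le> 1" unfolding grad_sup_norm_def
  proof (rule esssup_I)
    show "AE x in lebesgue_on \<Omega>. ereal (norm (weak_grad \<Omega> u x)) \<le> 1"
      using weak_grad_AE_eq[OF assms(1) g(1)] g(2) by eventually_elim simp
  qed (use wm in measurable)
  moreover have "u \<in> sobolev 1 \<infinity> \<Omega>"
    using u gb g(1) by (auto simp: has_weak_grad_def)
  ultimately show "u \<in> K0 \<Omega>" using r by (simp add: K0_def)
qed

section \<open>A weak gradient bounded by one forces Lipschitz continuity\<close>

lemma integral_compact_support:
  fixes f :: "'a::euclidean_space \<Rightarrow> real"
  assumes K: "compact K" and f: "continuous_on UNIV f" "\<And>x. x \<notin> K \<Longrightarrow> f x = 0"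
  shows "integrable lborel f"
    and "K \<subseteq> S \<Longrightarrow> integral S f = (LINT x|lborel. f x)"
    and "open \<Omega> \<Longrightarrow> K \<subseteq> \<Omega> \<Longrightarrow> (LINT x|lebesgue_on \<Omega>. f x) = (LINT x|lborel. f x)"
proof -
  have "integrable lborel (\<lambda>x. indicator K x *\<^sub>R f x)"
    by (rule borel_integrable_compact) (use K continuous_on_subset[OF f(1)] in auto)
  moreover have "(\<lambda>x. indicator K x *\<^sub>R f x) = f"
    using f(2) by (auto simp: indicator_def fun_eq_iff)
  ultimately show int: "integrable lborel f" by simp
  show "integral S f = (LINT x|lborel. f x)" if "K \<subseteq> S"
  proof -
    have "(\<lambda>x. if x \<in> S then f x else 0) = f"
      using f(2) that by (auto simp: fun_eq_iff)
    then have "integral S f = integral UNIV f" by (metis integral_restrict_UNIV)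
    then show ?thesis using integral_lborel[OF int] by simp
  qed
  show "(LINT x|lebesgue_on \<Omega>. f x) = (LINT x|lborel. f x)" if "open \<Omega>" "K \<subseteq> \<Omega>"
  proof -
    have "(\<lambda>x. indicator \<Omega> x *\<^sub>R f x) = f"
      using f(2) that by (auto simp: indicator_def fun_eq_iff)
    then show ?thesis
      using that int
      by (simp add: integral_restrict_space integral_completion borel_measurable_integrable)
  qed
qed

lemma LINT_translate:
  fixes f :: "'a::euclidean_space \<Rightarrow> real"
  assumes "continuous_on UNIV f"
  shows "(LINT z|lborel. f (z - p)) = (LINT z|lborel. f z)"
proof -
  have "f \<in> borel_measurable borel" using assms by (rule borel_measurable_continuous_onI)
  then have "(LINT z|distr lborel borel ((+) (- p)). f z) = (LINT z|lborel. f (- p + z))"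
    by (intro integral_distr) auto
  then show ?thesis by (simp add: lborel_distr_plus)
qed

text \<open>
  Average \<open>u\<close> against a bump travelling along the segment from \<open>x\<close> to \<open>y\<close>. The derivative of
  this average in time falls on the bump, and the weak gradient moves it onto \<open>u\<close>; so the average
  changes at most at speed \<open>norm (y - x)\<close>. Shrinking the bump recovers the values of \<open>u\<close>.
\<close>

lemma weak_grad_bound_imp_segment_bound:
  fixes u :: "'a::euclidean_space \<Rightarrow> real"
  assumes "open \<Omega>" and u: "continuous_on UNIV u"
    and g: "has_weak_grad \<Omega> u g" "AE x in lebesgue_on \<Omega>. norm (g x) \<le> 1"
    and seg: "closed_segment x y \<subseteq> \<Omega>"
  shows "\<bar>u x - u y\<bar> \<le> norm (y - x)"
proof -
  obtain e where e: "e > 0" "(\<Union>p\<in>closed_segment x y. cball p e) \<subseteq> \<Omega>"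
    using compact_subset_open_imp_cball_epsilon_subset[OF compact_segment assms(1) seg] by metis
  have "bounded (\<Union>p\<in>closed_segment x y. cball p e)"
  proof -
    obtain r where r: "\<And>p. p \<in> closed_segment x y \<Longrightarrow> norm p \<le> r"
      using bounded_closed_segment[of x y] by (auto simp: bounded_iff)
    have "norm z \<le> r + e" if "p \<in> closed_segment x y" "dist p z \<le> e" for p z
      using r[OF that(1)] that(2) norm_triangle_ineq[of p "z - p"]
      by (simp add: dist_norm norm_minus_commute)
    then show ?thesis unfolding bounded_iff by (intro exI[of _ "r + e"]) auto
  qed
  then obtain a where a: "(\<Union>p\<in>closed_segment x y. cball p e) \<subseteq> cbox (- a) a"
    using bounded_subset_cbox_symmetric by metis
  define d where "d = y - x"
  define P where "P t = x + t *\<^sub>R d" for t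
  have P: "P t \<in> closed_segment x y" if "t \<in> {0..1}" for t
    using that unfolding P_def d_def closed_segment_def mem_Collect_eq
    by (intro exI[of _ t]) (simp add: algebra_simps)
  have approx: "\<bar>u x - u y\<bar> \<le> norm d + 2 * \<epsilon>" if \<epsilon>: "\<epsilon> > 0" for \<epsilon>
  proof -
    have "isCont u x" "isCont u y" using u by (auto simp: continuous_on_eq_continuous_at)
    then obtain \<eta> where \<eta>: "\<eta> > 0" "\<And>z. dist z x \<le> \<eta> \<Longrightarrow> \<bar>u z - u x\<bar> \<le> \<epsilon>"
      "\<And>z. dist z y \<le> \<eta> \<Longrightarrow> \<bar>u z - u y\<bar> \<le> \<epsilon>"
    proof -
      obtain \<eta>1 where 1: "\<eta>1 > 0" "\<And>z. dist z x < \<eta>1 \<Longrightarrow> dist (u z) (u x) < \<epsilon>"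
        using \<open>isCont u x\<close> \<epsilon> unfolding continuous_at_eps_delta by metis
      obtain \<eta>2 where 2: "\<eta>2 > 0" "\<And>z. dist z y < \<eta>2 \<Longrightarrow> dist (u z) (u y) < \<epsilon>"
        using \<open>isCont u y\<close> \<epsilon> unfolding continuous_at_eps_delta by metis
      show thesis
      proof (rule that[of "min \<eta>1 \<eta>2 / 2"])
        show "0 < min \<eta>1 \<eta>2 / 2" using 1(1) 2(1) by simp
        show "\<bar>u z - u x\<bar> \<le> \<epsilon>" if "dist z x \<le> min \<eta>1 \<eta>2 / 2" for z
          using that 1(1) 2(1) 1(2)[of z] by (simp add: dist_real_def)
        show "\<bar>u z - u y\<bar> \<le> \<epsilon>" if "dist z y \<le> min \<eta>1 \<eta>2 / 2" for z
          using that 1(1) 2(1) 2(2)[of z] by (simp add: dist_real_def)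
      qed
    qed
    define \<delta> where "\<delta> = min e \<eta> / real DIM('a)"
    have \<delta>: "\<delta> > 0" "real DIM('a) * \<delta> \<le> min e \<eta>"
      using e(1) \<eta>(1) by (auto simp: \<delta>_def)
    define Q where "Q p = cbox (p - \<delta> *\<^sub>R One) (p + \<delta> *\<^sub>R One)" for p :: 'a
    have Qe: "Q p \<subseteq> cball p e" and Q\<eta>: "Q p \<subseteq> cball p \<eta>" for p
      using cube_subset_cball[of \<delta> e p] cube_subset_cball[of \<delta> \<eta> p] \<delta> by (auto simp: Q_def)
    have QP: "Q (P t) \<subseteq> \<Omega>" "Q (P t) \<subseteq> cbox (- a) a" if "t \<in> {0..1}" for t
      using Qe[of "P t"] e(2) a P[OF that] by blast+
    have cQ: "compact (Q p)" for p by (simp add: Q_def)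
    define \<phi> where "\<phi> = bump 1 (- (\<delta> *\<^sub>R One)) (\<delta> *\<^sub>R One :: 'a)"
    have shift: "bump 1 (p - \<delta> *\<^sub>R One) (p + \<delta> *\<^sub>R One) z = \<phi> (z - p)" for p z
      using bump_translate[of 1 "- (\<delta> *\<^sub>R One)" p "\<delta> *\<^sub>R One"] by (simp add: \<phi>_def add.commute)
    have supp: "\<phi> (z - p) = 0" if "z \<notin> Q p" for z p
    proof -
      have "z \<notin> box (p - \<delta> *\<^sub>R One) (p + \<delta> *\<^sub>R One)"
        using that box_subset_cbox unfolding Q_def by blast
      then show ?thesis using bump_eq_0[OF zero_less_one] by (simp add: shift[symmetric])
    qed
    have range: "0 \<le> \<phi> z" for z by (simp add: \<phi>_def bump_range)
    have c\<phi>: "continuous_on UNIV \<phi>" by (simp add: \<phi>_def continuous_bump)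
    have c\<phi>s: "continuous_on UNIV (\<lambda>z. \<phi> (z - p))" for p
      by (rule continuous_on_compose2[OF c\<phi>]) (auto intro!: continuous_intros)
    have Ck\<phi>: "Ck_on k UNIV \<phi>" for k by (simp add: \<phi>_def Ck_on_bump)
    define D where "D z = frechet_derivative \<phi> (at z)" for z
    have D: "(\<phi> has_derivative D z) (at z)" for z
      unfolding D_def by (rule Ck_on_has_derivative[OF Ck\<phi>])
    have cD: "continuous_on UNIV (\<lambda>z. D z b)" if "b \<in> Basis" for b
      using Ck\<phi>[of "Suc 0"] that by (simp add: D_def)
    have Ds: "((\<lambda>z. \<phi> (z - p)) has_derivative D (z - p)) (at z)" for z p
      by (rule has_derivative_compose[OF _ D, of "\<lambda>z. z - p" "\<lambda>h. h", simplified])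
        (auto intro!: derivative_eq_intros)
    have test: "test_function \<Omega> (\<lambda>z. \<phi> (z - P t))" if "t \<in> {0..1}" for t
      using test_function_bump[of 1 "P t - \<delta> *\<^sub>R One" "P t + \<delta> *\<^sub>R One" \<Omega>] QP(1)[OF that]
      by (simp add: Q_def shift[abs_def])
    have Dsupp: "D (z - p) b = 0" if "z \<notin> Q p" for z p b
    proof -
      have "((\<lambda>_. 0) has_derivative (\<lambda>_. 0)) (at z)" by simp
      then have "((\<lambda>z. \<phi> (z - p)) has_derivative (\<lambda>_. 0)) (at z)"
        by (rule has_derivative_transform_within_open[where s = "- Q p"])
          (use that supp cQ in \<open>auto simp: open_Compl compact_imp_closed\<close>)
      then show ?thesis using has_derivative_unique[OF Ds] by metis
    qed
    define c where "c = (LINT z|lborel. \<phi> z)"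
    have int\<phi>: "integrable lborel (\<lambda>z. \<phi> (z - p))" for p
      by (rule integral_compact_support(1)[OF cQ c\<phi>s supp])
    have ct: "(LINT z|lborel. \<phi> (z - p)) = c" for p
      unfolding c_def by (rule LINT_translate[OF c\<phi>])
    have "c > 0"
    proof (rule ccontr)
      assume "\<not> c > 0"
      moreover have "c \<ge> 0" unfolding c_def by (rule integral_nonneg_AE) (simp add: range)
      ultimately have "(LINT z|lborel. \<phi> z) = 0" by (simp add: c_def)
      then have "AE z in lborel. \<phi> z = 0"
        using integral_nonneg_eq_0_iff_AE[OF int\<phi>[of 0]] range by simp
      then have "AE z in lborel. z \<notin> box (- (\<delta> *\<^sub>R One)) (\<delta> *\<^sub>R One :: 'a)"
        by eventually_elim (metis \<phi>_def bump_pos_iff less_irrefl zero_less_one)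
      then have "box (- (\<delta> *\<^sub>R One)) (\<delta> *\<^sub>R One :: 'a) \<in> null_sets lborel"
        by (subst AE_iff_null_sets) auto
      then have "negligible (box (- (\<delta> *\<^sub>R One)) (\<delta> *\<^sub>R One :: 'a))"
        by (simp add: negligible_iff_null_sets null_sets_completionI)
      moreover have "0 \<in> box (- (\<delta> *\<^sub>R One)) (\<delta> *\<^sub>R One :: 'a)" using \<delta>(1) by (simp add: mem_box)
      ultimately show False using open_not_negligible[OF open_box] by blast
    qed
    define F where "F t = integral (cbox (- a) a) (\<lambda>z. u z * \<phi> (z - P t))" for t
    define f' where "f' t z = u z * - (\<Sum>b\<in>Basis. (d \<bullet> b) * D (z - P t) b)" for t z
    have Dd: "D z d = (\<Sum>b\<in>Basis. (d \<bullet> b) * D z b)" for z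
    proof -
      have "linear (D z)" using D has_derivative_linear by blast
      then have "D z (\<Sum>b\<in>Basis. (d \<bullet> b) *\<^sub>R b) = (\<Sum>b\<in>Basis. (d \<bullet> b) *\<^sub>R D z b)"
        by (simp add: linear_sum linear_scale)
      then show ?thesis by (simp add: euclidean_representation)
    qed
    have cP: "continuous_on S P" for S unfolding P_def by (intro continuous_intros)
    have F': "(F has_field_derivative integral (cbox (- a) a) (f' t)) (at t within {0..1})"
      if "t \<in> {0..1}" for t
      unfolding F_def
    proof (rule leibniz_rule_field_derivative)
      fix t z assume "t \<in> {0..1::real}"
      have "((\<lambda>t. z - P t) has_derivative (\<lambda>h. h *\<^sub>R (- d))) (at t within {0..1})"
        unfolding P_def by (auto intro!: derivative_eq_intros)
      from has_derivative_compose[OF this D]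
      have "((\<lambda>t. \<phi> (z - P t)) has_derivative (\<lambda>h. D (z - P t) (h *\<^sub>R (- d)))) (at t within {0..1})" .
      moreover have "D (z - P t) (h *\<^sub>R (- d)) = - D (z - P t) d * h" for h
      proof -
        have "linear (D (z - P t))" using D has_derivative_linear by blast
        then show ?thesis by (simp add: linear_scale linear_neg)
      qed
      ultimately have "((\<lambda>t. \<phi> (z - P t)) has_field_derivative - D (z - P t) d) (at t within {0..1})"
        by (simp only: has_field_derivative_def)
      from DERIV_cmult[OF this, of "u z"]
      show "((\<lambda>t. u z * \<phi> (z - P t)) has_field_derivative f' t z) (at t within {0..1})"
        by (simp add: f'_def Dd)
    next
      show "(\<lambda>z. u z * \<phi> (z - P t)) integrable_on cbox (- a) a" for t
        by (intro integrable_continuous continuous_intros continuous_on_subset[OF u]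
            continuous_on_subset[OF c\<phi>s]) auto
      have "continuous_on ({0..1} \<times> cbox (- a) a) (\<lambda>w. f' (fst w) (snd w))"
        unfolding f'_def
        by (intro continuous_intros continuous_on_compose2[OF u] continuous_on_compose2[OF cD]
            continuous_on_compose2[OF cP[of UNIV]]) auto
      then show "continuous_on ({0..1} \<times> cbox (- a) a) (\<lambda>(t, z). f' t z)"
        by (simp add: split_beta)
    qed (use that in auto)
    have gm: "g \<in> borel_measurable (lebesgue_on \<Omega>)"
      by (rule has_weak_grad_measurable[OF assms(1) g(1)])
    \<comment> \<open>Integration by parts turns the time derivative of the average into an average of \<open>g z \<bullet> d\<close>.\<close>
    have F'_le: "norm (integral (cbox (- a) a) (f' t)) \<le> c * norm d" if t: "t \<in> {0..1}" for t
    proof -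
      let ?\<phi> = "\<lambda>z. \<phi> (z - P t)"
      note supp_t = integrable_mult_compact_support[OF assms(1) _ cQ QP(1)[OF t]]
      have cf': "continuous_on UNIV (f' t)"
        unfolding f'_def
        by (intro continuous_intros continuous_on_compose2[OF u] continuous_on_compose2[OF cD]) auto
      have zf': "f' t z = 0" if "z \<notin> Q (P t)" for z
        using Dsupp[OF that] by (simp add: f'_def)
      have "integral (cbox (- a) a) (f' t) = (LINT z|lebesgue_on \<Omega>. f' t z)"
        using integral_compact_support(2)[OF cQ cf' zf' QP(2)[OF t]]
          integral_compact_support(3)[OF cQ cf' zf' assms(1) QP(1)[OF t]] by simp
      also have "\<dots> = (LINT z|lebesgue_on \<Omega>. (\<Sum>b\<in>Basis. - (d \<bullet> b) * (u z * D (z - P t) b)))"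
        by (intro Bochner_Integration.integral_cong refl)
          (simp add: f'_def sum_distrib_left sum_negf mult_ac)
      also have "\<dots> = (\<Sum>b\<in>Basis. (LINT z|lebesgue_on \<Omega>. - (d \<bullet> b) * (u z * D (z - P t) b)))"
      proof (rule Bochner_Integration.integral_sum)
        fix b :: 'a assume "b \<in> Basis"
        then have "integrable (lebesgue_on \<Omega>) (\<lambda>z. u z * D (z - P t) b)"
          by (intro supp_t locally_integrable_continuous continuous_on_subset[OF u]
              continuous_on_compose2[OF cD] continuous_intros) (auto simp: Dsupp)
        then show "integrable (lebesgue_on \<Omega>) (\<lambda>z. - (d \<bullet> b) * (u z * D (z - P t) b))"
          by (rule integrable_mult_right)
      qed
      also have "\<dots> = (\<Sum>b\<in>Basis. (LINT z|lebesgue_on \<Omega>. (d \<bullet> b) * (g z \<bullet> b * ?\<phi> z)))"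
      proof (rule sum.cong[OF refl])
        fix b :: 'a assume "b \<in> Basis"
        then have "(LINT z|lebesgue_on \<Omega>. u z * frechet_derivative ?\<phi> (at z) b)
            = - (LINT z|lebesgue_on \<Omega>. g z \<bullet> b * ?\<phi> z)"
          using g(1) test[OF t] by (auto simp: has_weak_grad_def has_weak_partial_def)
        moreover have "frechet_derivative ?\<phi> (at z) = D (z - P t)" for z
          using frechet_derivative_at[OF Ds] by simp
        ultimately have "(LINT z|lebesgue_on \<Omega>. u z * D (z - P t) b)
            = - (LINT z|lebesgue_on \<Omega>. g z \<bullet> b * ?\<phi> z)" by simp
        then show "(LINT z|lebesgue_on \<Omega>. - (d \<bullet> b) * (u z * D (z - P t) b))
            = (LINT z|lebesgue_on \<Omega>. (d \<bullet> b) * (g z \<bullet> b * ?\<phi> z))"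
          by simp
      qed
      also have "\<dots> = (LINT z|lebesgue_on \<Omega>. (\<Sum>b\<in>Basis. (d \<bullet> b) * (g z \<bullet> b * ?\<phi> z)))"
      proof (rule Bochner_Integration.integral_sum[symmetric])
        fix b :: 'a assume "b \<in> Basis"
        then have "integrable (lebesgue_on \<Omega>) (\<lambda>z. g z \<bullet> b * ?\<phi> z)"
          using g(1) by (intro supp_t c\<phi>s supp) (auto simp: has_weak_grad_def has_weak_partial_def)
        then show "integrable (lebesgue_on \<Omega>) (\<lambda>z. (d \<bullet> b) * (g z \<bullet> b * ?\<phi> z))"
          by (rule integrable_mult_right)
      qed
      also have "\<dots> = (LINT z|lebesgue_on \<Omega>. (g z \<bullet> d) * ?\<phi> z)"
        by (intro Bochner_Integration.integral_cong refl)
          (simp add: euclidean_inner[of _ d] sum_distrib_left sum_distrib_right mult_ac)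
      finally have eq: "integral (cbox (- a) a) (f' t) = (LINT z|lebesgue_on \<Omega>. (g z \<bullet> d) * ?\<phi> z)" .
      have gd: "AE z in lebesgue_on \<Omega>. \<bar>g z \<bullet> d\<bar> \<le> norm d"
        using g(2)
      proof eventually_elim
        case (elim z)
        have "\<bar>g z \<bullet> d\<bar> \<le> norm (g z) * norm d" by (rule Cauchy_Schwarz_ineq2)
        also have "\<dots> \<le> 1 * norm d" using elim by (intro mult_right_mono) auto
        finally show ?case by simp
      qed
      have "norm (LINT z|lebesgue_on \<Omega>. (g z \<bullet> d) * ?\<phi> z)
          \<le> (LINT z|lebesgue_on \<Omega>. norm ((g z \<bullet> d) * ?\<phi> z))"
        by (rule integral_norm_bound)
      also have "\<dots> \<le> (LINT z|lebesgue_on \<Omega>. norm d * ?\<phi> z)"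
      proof (rule integral_mono_AE)
        show "integrable (lebesgue_on \<Omega>) (\<lambda>z. norm ((g z \<bullet> d) * ?\<phi> z))"
          by (intro integrable_norm supp_t locally_integrable_bounded[OF assms(1) _ gd] c\<phi>s supp)
            (use gm in measurable)
        show "integrable (lebesgue_on \<Omega>) (\<lambda>z. norm d * ?\<phi> z)"
          by (intro supp_t locally_integrable_continuous continuous_intros c\<phi>s supp)
        show "AE z in lebesgue_on \<Omega>. norm ((g z \<bullet> d) * ?\<phi> z) \<le> norm d * ?\<phi> z"
          using gd by eventually_elim (simp add: abs_mult range mult_right_mono)
      qed
      also have "\<dots> = norm d * (LINT z|lborel. ?\<phi> z)"
        using integral_compact_support(3)[OF cQ c\<phi>s supp assms(1) QP(1)[OF t]] by simp
      finally show ?thesis using eq ct by (simp add: mult.commute)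
    qed
    have "norm (F 0 - F 1) \<le> c * norm d * norm (0 - 1 :: real)"
      by (rule field_differentiable_bound[of "{0..1}", OF _ F' F'_le]) auto
    moreover have "\<bar>F t - c * u (P t)\<bar> \<le> \<epsilon> * c" if t: "t \<in> {0..1}"
      and near: "\<And>z. z \<in> Q (P t) \<Longrightarrow> \<bar>u z - u (P t)\<bar> \<le> \<epsilon>" for t
    proof -
      let ?\<phi> = "\<lambda>z. \<phi> (z - P t)"
      have cu\<phi>: "continuous_on UNIV (\<lambda>z. u z * ?\<phi> z)" by (intro continuous_intros u c\<phi>s)
      have zu\<phi>: "u z * ?\<phi> z = 0" if "z \<notin> Q (P t)" for z using supp[OF that] by simp
      have int: "integrable lborel (\<lambda>z. u z * ?\<phi> z)"
        by (rule integral_compact_support(1)[OF cQ cu\<phi> zu\<phi>])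
      have "F t - c * u (P t) = (LINT z|lborel. u z * ?\<phi> z - u (P t) * ?\<phi> z)"
        using integral_compact_support(2)[OF cQ cu\<phi> zu\<phi> QP(2)[OF t]] int int\<phi>
        by (simp add: F_def ct)
      also have "\<bar>\<dots>\<bar> \<le> (LINT z|lborel. norm (u z * ?\<phi> z - u (P t) * ?\<phi> z))"
        using integral_norm_bound[of lborel "\<lambda>z. u z * ?\<phi> z - u (P t) * ?\<phi> z"] by simp
      also have "\<dots> \<le> (LINT z|lborel. \<epsilon> * ?\<phi> z)"
      proof (rule integral_mono)
        fix z
        show "norm (u z * ?\<phi> z - u (P t) * ?\<phi> z) \<le> \<epsilon> * ?\<phi> z"
        proof (cases "z \<in> Q (P t)")
          case True
          have "norm (u z * ?\<phi> z - u (P t) * ?\<phi> z) = \<bar>u z - u (P t)\<bar> * ?\<phi> z"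
            by (simp add: left_diff_distrib[symmetric] abs_mult range)
          then show ?thesis using near[OF True] range by (simp add: mult_right_mono)
        qed (simp add: supp)
      qed (use int int\<phi> in auto)
      finally show ?thesis by (simp add: ct)
    qed
    moreover have "\<bar>u z - u x\<bar> \<le> \<epsilon>" if "z \<in> Q x" for z
      using \<eta>(2)[of z] Q\<eta>[of x] that by (auto simp: dist_commute)
    moreover have "\<bar>u z - u y\<bar> \<le> \<epsilon>" if "z \<in> Q y" for z
      using \<eta>(3)[of z] Q\<eta>[of y] that by (auto simp: dist_commute)
    moreover have "P 0 = x" "P 1 = y" by (simp_all add: P_def d_def)
    ultimately have "norm (F 0 - F 1) \<le> c * norm d" "\<bar>F 0 - c * u x\<bar> \<le> \<epsilon> * c"
      "\<bar>F 1 - c * u y\<bar> \<le> \<epsilon> * c"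
      by (metis (no_types, lifting) atLeastAtMost_iff diff_0 mult.right_neutral norm_minus_cancel norm_one order.refl zero_le_one)+
    then have "\<bar>c * u x - c * u y\<bar> \<le> c * norm d + 2 * (\<epsilon> * c)"
      unfolding real_norm_def by linarith
    moreover have "\<bar>c * u x - c * u y\<bar> = c * \<bar>u x - u y\<bar>"
      using \<open>c > 0\<close> by (simp add: right_diff_distrib[symmetric] abs_mult)
    moreover have "c * norm d + 2 * (\<epsilon> * c) = c * (norm d + 2 * \<epsilon>)"
      by (simp add: distrib_left)
    ultimately have "c * \<bar>u x - u y\<bar> \<le> c * (norm d + 2 * \<epsilon>)" by simp
    then show ?thesis using \<open>c > 0\<close> by simp
  qed
  have "\<bar>u x - u y\<bar> \<le> norm d"
  proof (rule field_le_epsilon)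
    fix \<epsilon> :: real assume "\<epsilon> > 0"
    then show "\<bar>u x - u y\<bar> \<le> norm d + \<epsilon>" using approx[of "\<epsilon> / 2"] by simp
  qed
  then show ?thesis by (simp add: d_def)
qed

lemma has_weak_partial_cong:
  assumes "\<And>x. x \<in> \<Omega> \<Longrightarrow> u x = u' x"
  shows "has_weak_partial \<Omega> b u v \<longleftrightarrow> has_weak_partial \<Omega> b u' v"
proof -
  have "(LINT x|lebesgue_on \<Omega>. u x * f x) = (LINT x|lebesgue_on \<Omega>. u' x * f x)" for f
    using assms by (intro Bochner_Integration.integral_cong) auto
  moreover have "u absolutely_integrable_on K \<longleftrightarrow> u' absolutely_integrable_on K" if "K \<subseteq> \<Omega>" for K
    using assms that by (intro set_integrable_cong) auto
  then have "locally_integrable \<Omega> u \<longleftrightarrow> locally_integrable \<Omega> u'"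
    by (auto simp: locally_integrable_def)
  ultimately show ?thesis by (simp add: has_weak_partial_def)
qed

text \<open>
  A segment that leaves the domain meets the boundary, where the function vanishes; this turns the
  bound along segments into a global one.
\<close>

lemma K0_zero_extension_lipschitz:
  fixes \<Omega> :: "'a::euclidean_space set"
  assumes "open \<Omega>" "bounded \<Omega>" and u: "u \<in> K0 \<Omega>"
  defines "u0 \<equiv> \<lambda>x. if x \<in> \<Omega> then u x else 0"
  shows "\<bar>u0 x - u0 y\<bar> \<le> dist x y"
proof -
  obtain g where cont: "continuous_on (closure \<Omega>) u" and bd: "\<And>x. x \<in> frontier \<Omega> \<Longrightarrow> u x = 0"
    and g: "has_weak_grad \<Omega> u g" "AE x in lebesgue_on \<Omega>. norm (g x) \<le> 1"
    using u by (auto simp: K0_iff[OF assms(1,2)])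
  have g0: "has_weak_grad \<Omega> u0 g"
    using g(1) has_weak_partial_cong[of \<Omega> u0 u] by (simp add: has_weak_grad_def u0_def)
  have "continuous_on (closure \<Omega> \<union> - \<Omega>) (\<lambda>x. if x \<in> \<Omega> then u x else 0)"
    by (rule continuous_on_If)
      (use assms(1) cont bd in \<open>auto simp: frontier_def interior_open\<close>)
  moreover have "closure \<Omega> \<union> - \<Omega> = UNIV" using closure_subset by blast
  ultimately have c0: "continuous_on UNIV u0" by (simp add: u0_def)
  have inside: "\<bar>u0 x - u0 y\<bar> \<le> dist x y" if "closed_segment x y \<subseteq> \<Omega>" for x y
    using weak_grad_bound_imp_segment_bound[OF assms(1) c0 g0 g(2) that]
    by (simp add: dist_norm norm_minus_commute)
  have exit: "\<bar>u0 x\<bar> \<le> dist x w" if x: "x \<in> \<Omega>" and w: "w \<notin> \<Omega>" for x w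
  proof -
    define P where "P t = x + t *\<^sub>R (w - x)" for t
    have cP: "continuous_on S P" for S unfolding P_def by (intro continuous_intros)
    \<comment> \<open>The first exit time \<open>s\<close>: before it the segment bound applies, and at \<open>P s\<close> the function
      vanishes.\<close>
    define T where "T = {t \<in> {0..1}. P t \<in> - \<Omega>}"
    have "closed T" unfolding T_def
      by (rule continuous_closed_preimage[OF cP, unfolded vimage_def Int_def mem_Collect_eq])
        (use assms(1) in auto)
    then have "compact T" unfolding compact_eq_bounded_closed
      by (auto simp: T_def intro: bounded_subset[of "{0..1::real}"])
    moreover have "1 \<in> T" using w by (simp add: T_def P_def)
    ultimately obtain s where s: "s \<in> T" "\<And>t. t \<in> T \<Longrightarrow> s \<le> t"
      using compact_attains_inf[of T] by blast
    have "s \<noteq> 0" using s(1) x by (auto simp: T_def P_def)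
    then have s01: "0 < s" "s \<le> 1" using s(1) by (auto simp: T_def)
    have before: "\<bar>u0 x - u0 (P t)\<bar> \<le> dist x w" if t: "t \<in> {0..<s}" for t
    proof -
      have "closed_segment x (P t) \<subseteq> \<Omega>"
      proof
        fix z assume "z \<in> closed_segment x (P t)"
        then obtain r where r: "0 \<le> r" "r \<le> 1" "z = P (r * t)"
          by (auto simp: closed_segment_def P_def algebra_simps)
        have "0 \<le> r * t" "r * t < s" using r(1,2) t mult_left_le_one_le[of t r] by auto
        then show "z \<in> \<Omega>" using s(2)[of "r * t"] s01 r(3) by (force simp: T_def)
      qed
      then have "\<bar>u0 x - u0 (P t)\<bar> \<le> dist x (P t)" by (rule inside)
      also have "\<dots> = t * dist x w" using t by (simp add: P_def dist_norm norm_minus_commute)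
      also have "\<dots> \<le> dist x w" using t s01 by (intro mult_left_le_one_le) auto
      finally show ?thesis .
    qed
    have "\<bar>u0 x - u0 (P s)\<bar> \<le> dist x w"
    proof (rule continuous_le_on_closure[of "{0..<s}" "\<lambda>t. \<bar>u0 x - u0 (P t)\<bar>"])
      show "continuous_on (closure {0..<s}) (\<lambda>t. \<bar>u0 x - u0 (P t)\<bar>)"
        by (intro continuous_intros continuous_on_compose2[OF c0 cP]) auto
      show "s \<in> closure {0..<s}" using s01 by simp
    qed (use before in auto)
    moreover have "u0 (P s) = 0" using s(1) by (simp add: T_def u0_def)
    ultimately show ?thesis by simp
  qed
  have zero: "u0 z = 0" if "z \<notin> \<Omega>" for z using that by (simp add: u0_def)
  show ?thesis
  proof (cases "closed_segment x y \<subseteq> \<Omega>")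
    case False
    then obtain w where w: "w \<in> closed_segment x y" "w \<notin> \<Omega>" by blast
    have "\<bar>u0 x\<bar> \<le> dist x w" "\<bar>u0 y\<bar> \<le> dist y w"
      using exit[OF _ w(2)] zero by (cases "x \<in> \<Omega>"; cases "y \<in> \<Omega>"; simp)+
    moreover have "dist x y = dist x w + dist w y"
      using w(1) between_mem_segment between by metis
    ultimately show ?thesis by (simp add: dist_commute)
  qed (rule inside)
qed

corollary K0_lipschitz:
  fixes \<Omega> :: "'a::euclidean_space set"
  assumes "open \<Omega>" "bounded \<Omega>" "u \<in> K0 \<Omega>" "x \<in> closure \<Omega>" "y \<in> closure \<Omega>"
  shows "\<bar>u x - u y\<bar> \<le> dist x y"
proof -
  have "u z = (if z \<in> \<Omega> then u z else 0)" if "z \<in> closure \<Omega>" for z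
    using assms(1,3) that by (auto simp: K0_def frontier_def interior_open)
  from this[OF assms(4)] this[OF assms(5)] show ?thesis
    using K0_zero_extension_lipschitz[OF assms(1-3), of x y] by argo
qed

text \<open>The zero extension vanishes at any point outside the domain; comparing with one such point
  bounds it everywhere.\<close>

corollary K0_bounded:
  fixes \<Omega> :: "'a::euclidean_space set"
  assumes "open \<Omega>" "bounded \<Omega>"
  shows "\<exists>R>0. \<forall>u\<in>K0 \<Omega>. \<forall>x\<in>closure \<Omega>. \<bar>u x\<bar> \<le> R"
proof -
  obtain r where r: "\<And>x. x \<in> closure \<Omega> \<Longrightarrow> norm x \<le> r" "r > 0"
    using bounded_closure[OF assms(2)] bounded_pos by metis
  obtain b :: 'a where b: "norm b = r + 1"
    using vector_choose_size[of "r + 1"] r(2) by auto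
  then have "b \<notin> closure \<Omega>" using r(1) by force
  then have "b \<notin> \<Omega>" using closure_subset by blast
  have "\<bar>u x\<bar> \<le> 2 * r + 1" if u: "u \<in> K0 \<Omega>" and x: "x \<in> closure \<Omega>" for u x
  proof (cases "x \<in> \<Omega>")
    case True
    then have "\<bar>u x\<bar> \<le> dist x b"
      using K0_zero_extension_lipschitz[OF assms u, of x b] \<open>b \<notin> \<Omega>\<close> by simp
    also have "\<dots> \<le> norm x + norm b" by (simp add: dist_norm norm_triangle_ineq4)
    finally show ?thesis using r(1)[OF x] b by simp
  next
    case False
    then have "u x = 0" using u x assms(1) by (auto simp: K0_def frontier_def interior_open)
    then show ?thesis using r(2) by simp
  qed
  then show ?thesis using r(2) by (intro exI[of _ "2 * r + 1"]) auto
qed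

section \<open>The convex constraint set is closed under uniform convergence\<close>

text \<open>
  A substitute for weak compactness. Elements of almost minimal \<open>L\<^sup>2\<close> norm in a decreasing sequence of
  midpoint-convex sets form a Cauchy sequence by the parallelogram law, because the midpoint of a
  late and an early element is again a competitor for the early minimum. A fast subsequence
  converges almost everywhere.
\<close>

lemma (in finite_measure) midpoint_convex_AE_convergent_selection:
  fixes G :: "nat \<Rightarrow> ('a \<Rightarrow> 'b::euclidean_space) set"
  assumes ne: "\<And>n. G n \<noteq> {}" and dec: "decseq G"
    and meas: "\<And>n f. f \<in> G n \<Longrightarrow> f \<in> borel_measurable M"
    and bound: "\<And>n f. f \<in> G n \<Longrightarrow> AE x in M. norm (f x) \<le> 1"
    and mid: "\<And>n f g. f \<in> G n \<Longrightarrow> g \<in> G n \<Longrightarrow> (\<lambda>x. (1/2) *\<^sub>R f x + (1/2) *\<^sub>R g x) \<in> G n"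
  obtains f g where "\<And>n. f n \<in> G n" "g \<in> borel_measurable M" "AE x in M. (\<lambda>n. f n x) \<longlonglongrightarrow> g x"
proof -
  define m where "m = measure M (space M)"
  define J where "J f = (LINT x|M. (norm (f x))\<^sup>2)" for f :: "'a \<Rightarrow> 'b"
  define d where "d n = (INF f\<in>G n. J f)" for n
  have intJ: "integrable M (\<lambda>x. (norm (f x))\<^sup>2)" if "f \<in> G n" for f n
  proof (rule integrable_const_bound[where B = 1])
    show "AE x in M. norm ((norm (f x))\<^sup>2) \<le> 1"
      using bound[OF that] by eventually_elim (simp add: power_le_one)
  qed (use meas[OF that] in measurable)
  have J0: "0 \<le> J f" for f by (simp add: J_def)
  have Jm: "J f \<le> m" if "f \<in> G n" for f n
  proof -
    have "J f \<le> (LINT x|M. 1)" unfolding J_def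
      using bound[OF that] intJ[OF that]
      by (intro integral_mono_AE) (auto elim!: eventually_mono simp: power_le_one)
    then show ?thesis by (simp add: m_def)
  qed
  have bdd: "bdd_below (J ` G n)" for n using J0 by (intro bdd_belowI2[of _ 0]) auto
  have dJ: "d n \<le> J f" if "f \<in> G n" for n f unfolding d_def by (rule cINF_lower[OF bdd that])
  have "incseq d" unfolding incseq_Suc_iff d_def
    using dec by (intro allI cINF_superset_mono bdd ne) (auto simp: decseq_Suc_iff)
  moreover have "d n \<le> m" for n
  proof -
    obtain f where "f \<in> G n" using ne by blast
    then show ?thesis using dJ Jm order_trans by blast
  qed
  ultimately obtain L where L: "d \<longlonglongrightarrow> L" "\<And>n. d n \<le> L"
    using incseq_convergent by blast
  have "\<exists>f\<in>G n. J f < d n + 1 / real (Suc n)" for n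
    using cINF_less_iff[OF ne bdd, of n "d n + 1 / real (Suc n)"] by (simp add: d_def)
  then obtain f where f: "\<And>n. f n \<in> G n" "\<And>n. J (f n) < d n + 1 / real (Suc n)"
    by metis
  have fG: "f k \<in> G n" if "n \<le> k" for n k using f(1) dec that by (auto dest: decseqD)
  \<comment> \<open>The squared \<open>L\<^sup>2\<close> distance of the selected elements is controlled by the gap \<open>L - d n\<close> between
    the minimal values and by the tolerance of the selection.\<close>
  define A where "A n k = (LINT x|M. (norm (f k x - f n x))\<^sup>2)" for n k
  define c where "c n = 2 * (L - d n) + 4 * (1 / real (Suc n))" for n
  have para: "(norm (p - q))\<^sup>2 = 2 * (norm p)\<^sup>2 + 2 * (norm q)\<^sup>2
      - 4 * (norm ((1/2) *\<^sub>R p + (1/2) *\<^sub>R q))\<^sup>2" for p q :: 'b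
    by (simp add: power2_norm_eq_inner inner_add_left inner_add_right inner_diff_left
        inner_diff_right inner_commute)
  have A: "A n k \<le> c n" if "n \<le> k" for n k
  proof -
    let ?h = "\<lambda>x. (1/2) *\<^sub>R f k x + (1/2) *\<^sub>R f n x"
    have h: "?h \<in> G n" by (rule mid[OF fG[OF that] f(1)])
    have "A n k = 2 * J (f k) + 2 * J (f n) - 4 * J ?h"
      unfolding A_def J_def para using intJ[OF f(1)] intJ[OF h] by simp
    also have "\<dots> \<le> 2 * (d k + 1 / real (Suc k)) + 2 * (d n + 1 / real (Suc n)) - 4 * d n"
      using less_imp_le[OF f(2)[of k]] less_imp_le[OF f(2)[of n]] dJ[OF h]
      by (intro diff_mono add_mono mult_left_mono) auto
    also have "\<dots> \<le> 2 * (L + 1 / real (Suc n)) + 2 * (d n + 1 / real (Suc n)) - 4 * d n"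
      using L(2)[of k] that by (intro diff_right_mono add_right_mono mult_left_mono add_mono)
        (auto simp: frac_le)
    also have "\<dots> = c n" by (simp add: c_def)
    finally show ?thesis .
  qed
  have "c \<longlonglongrightarrow> 2 * (L - L) + 4 * 0" unfolding c_def
    by (intro tendsto_intros L(1) LIMSEQ_Suc[OF lim_1_over_n])
  then have "c \<longlonglongrightarrow> 0" by simp
  then have "\<exists>N. \<forall>n\<ge>N. c n < (1/4) ^ j" for j
    using order_tendstoD(2)[of c 0 sequentially "(1/4) ^ j"] by (simp add: eventually_sequentially)
  then obtain N where N: "\<And>j n. N j \<le> n \<Longrightarrow> c n < (1/4) ^ j" by metis
  \<comment> \<open>Beyond \<open>N j\<close> the squared distances are below \<open>4\<close> to the power \<open>- j\<close>, which makes the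
    \<open>L\<^sup>1\<close> distances of successive elements summable; \<open>r\<close> is nondecreasing and dominates both \<open>N\<close> and
    the identity.\<close>
  define r where "r j = j + (\<Sum>i\<le>j. N i)" for j
  have r: "j \<le> r j" "N j \<le> r j" "r j \<le> r (Suc j)" for j
    using member_le_sum[of j "{..j}" N] by (auto simp: r_def)
  define D where "D j x = norm (f (r (Suc j)) x - f (r j) x)" for j x
  have Dm [measurable]: "D j \<in> borel_measurable M" for j
    unfolding D_def using meas[OF f(1)] by measurable
  have intD2: "integrable M (\<lambda>x. (D j x)\<^sup>2)" for j
  proof (rule integrable_const_bound[where B = 4])
    show "AE x in M. norm ((D j x)\<^sup>2) \<le> 4"
      using bound[OF f(1)[of "r j"]] bound[OF f(1)[of "r (Suc j)"]]
    proof eventually_elim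
      case (elim x)
      then have "D j x \<le> 2"
        using norm_triangle_ineq4[of "f (r (Suc j)) x" "f (r j) x"] by (simp add: D_def)
      then have "(D j x)\<^sup>2 \<le> 2\<^sup>2" by (rule power_mono) (simp add: D_def)
      then show ?case by simp
    qed
  qed measurable
  have D2: "(LINT x|M. (D j x)\<^sup>2) \<le> (1/4) ^ j" for j
    using A[OF r(3)[of j]] N[OF r(2)[of j]] by (simp add: A_def D_def)
  have nnD: "(\<integral>\<^sup>+x. ennreal (D j x) \<partial>M) \<le> ennreal ((1 + m) * (1/2) ^ j)" for j
  proof -
    \<comment> \<open>Either the difference is at most \<open>(1/2) ^ j\<close>, or one more factor \<open>2 ^ j * D j x\<close> is at
      least one.\<close>
    have pt: "D j x \<le> 2 ^ j * (D j x)\<^sup>2 + (1/2) ^ j" for x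
    proof (cases "D j x \<le> (1/2) ^ j")
      case True
      then show ?thesis by (simp add: add_increasing)
    next
      case False
      then have "1 \<le> 2 ^ j * D j x" by (simp add: power_one_over field_simps)
      then have "D j x * 1 \<le> D j x * (2 ^ j * D j x)"
        by (intro mult_left_mono) (auto simp: D_def)
      then show ?thesis by (simp add: power2_eq_square mult_ac add_increasing2)
    qed
    have "(\<integral>\<^sup>+x. ennreal (D j x) \<partial>M) \<le> (\<integral>\<^sup>+x. ennreal (2 ^ j * (D j x)\<^sup>2 + (1/2) ^ j) \<partial>M)"
      by (intro nn_integral_mono ennreal_leI pt)
    also have "\<dots> = ennreal (LINT x|M. 2 ^ j * (D j x)\<^sup>2 + (1/2) ^ j)"
      using intD2 by (intro nn_integral_eq_integral) auto
    also have "(LINT x|M. 2 ^ j * (D j x)\<^sup>2 + (1/2) ^ j) = 2 ^ j * (LINT x|M. (D j x)\<^sup>2) + (1/2) ^ j * m"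
      using intD2 by (simp add: m_def)
    also have "ennreal \<dots> \<le> ennreal ((1 + m) * (1/2) ^ j)"
    proof (rule ennreal_leI)
      have "2 ^ j * (LINT x|M. (D j x)\<^sup>2) \<le> 2 ^ j * (1/4) ^ j"
        using D2 by (rule mult_left_mono) simp
      also have "\<dots> = (1/2) ^ j" by (simp add: power_mult_distrib[symmetric])
      finally show "2 ^ j * (LINT x|M. (D j x)\<^sup>2) + (1/2) ^ j * m \<le> (1 + m) * (1/2) ^ j"
        by (simp add: algebra_simps)
    qed
    finally show ?thesis .
  qed
  have "(\<integral>\<^sup>+x. (\<Sum>j. ennreal (D j x)) \<partial>M) = (\<Sum>j. \<integral>\<^sup>+x. ennreal (D j x) \<partial>M)"
    by (rule nn_integral_suminf) measurable
  also have "\<dots> \<le> (\<Sum>j. ennreal ((1 + m) * (1/2) ^ j))"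
    by (intro suminf_le nnD) auto
  also have "\<dots> = ennreal (\<Sum>j. (1 + m) * (1/2) ^ j)"
    by (intro suminf_ennreal2) (auto simp: m_def intro!: summable_mult summable_geometric)
  also have "\<dots> < \<infinity>" by simp
  finally have "AE x in M. (\<Sum>j. ennreal (D j x)) \<noteq> \<infinity>"
    by (intro nn_integral_PInf_AE) auto
  then have conv: "AE x in M. (\<lambda>j. f (r j) x) \<longlonglongrightarrow> lim (\<lambda>j. f (r j) x)"
  proof eventually_elim
    case (elim x)
    have "summable (\<lambda>j. D j x)"
      by (rule summable_suminf_not_top) (use elim in \<open>auto simp: D_def\<close>)
    then have "summable (\<lambda>j. f (r (Suc j)) x - f (r j) x)"
      unfolding D_def by (rule summable_norm_cancel)
    then have "convergent (\<lambda>n. f (r n) x - f (r 0) x)"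
      by (simp only: summable_iff_convergent sum_lessThan_telescope[of "\<lambda>j. f (r j) x"])
    then have "convergent (\<lambda>n. f (r n) x)" by (simp add: convergent_diff_const_right_iff)
    then show ?case by (simp add: convergent_LIMSEQ_iff)
  qed
  show thesis
  proof (rule that[of "\<lambda>j. f (r j)" "\<lambda>x. lim (\<lambda>j. f (r j) x)"])
    show "f (r n) \<in> G n" for n by (rule fG[OF r(1)])
    show "(\<lambda>x. lim (\<lambda>j. f (r j) x)) \<in> borel_measurable M"
      by (intro borel_measurable_lim_metric meas[OF f(1)])
  qed (rule conv)
qed

text \<open>
  The weak gradients bounded by one of functions uniformly close to the limit form the decreasing
  midpoint-convex sets. Almost everywhere convergence keeps the bound by one, and dominated
  convergence passes to the limit in the definition of the weak gradient.
\<close>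

lemma K0_uniform_limit:
  fixes \<Omega> :: "'a::euclidean_space set"
  assumes "open \<Omega>" "bounded \<Omega>" and u: "\<And>n. u n \<in> K0 \<Omega>"
    and lim: "uniform_limit (closure \<Omega>) u v sequentially"
  shows "v \<in> K0 \<Omega>"
proof -
  interpret finite_measure "lebesgue_on \<Omega>" 
    by (rule finite_measure_lebesgue_on[OF lmeasurable_open[OF assms(2,1)]])
  have sub: "\<Omega> \<subseteq> closure \<Omega>" by (rule closure_subset)
  have contv: "continuous_on (closure \<Omega>) v"
    by (rule uniform_limit_theorem[OF _ lim]) (use u in \<open>auto simp: K0_def\<close>)
  have zerov: "v x = 0" if "x \<in> frontier \<Omega>" for x
  proof -
    have "(\<lambda>n. u n x) \<longlonglongrightarrow> v x"
      using tendsto_uniform_limitI[OF lim] that by (simp add: frontier_def)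
    moreover have "u n x = 0" for n using u that by (auto simp: K0_def)
    ultimately show ?thesis by (simp add: LIMSEQ_const_iff)
  qed
  \<comment> \<open>Closeness to \<open>v\<close> instead of membership in convex hulls of the tails of \<open>u\<close>: these sets are
    visibly convex.\<close>
  define G where "G n = {g. (AE x in lebesgue_on \<Omega>. norm (g x) \<le> 1) \<and>
      (\<exists>w. has_weak_grad \<Omega> w g \<and> (\<forall>x\<in>\<Omega>. \<bar>w x - v x\<bar> \<le> 1 / real (Suc n)))}" for n
  have ne: "G n \<noteq> {}" for n
  proof -
    have "\<forall>\<^sub>F k in sequentially. \<forall>x\<in>closure \<Omega>. dist (u k x) (v x) < 1 / real (Suc n)"
      using lim by (rule uniform_limitD) simp
    then obtain k where k: "\<And>x. x \<in> closure \<Omega> \<Longrightarrow> dist (u k x) (v x) < 1 / real (Suc n)"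
      by (auto simp: eventually_sequentially)
    obtain g where "has_weak_grad \<Omega> (u k) g" "AE x in lebesgue_on \<Omega>. norm (g x) \<le> 1"
      using u[of k] by (auto simp: K0_iff[OF assms(1,2)])
    moreover have "\<bar>u k x - v x\<bar> \<le> 1 / real (Suc n)" if "x \<in> \<Omega>" for x
      using k[of x] sub that by (auto simp: dist_real_def)
    ultimately have "g \<in> G n" unfolding G_def by blast
    then show ?thesis by blast
  qed
  have decG: "decseq G"
  proof (unfold decseq_Suc_iff, intro allI subsetI)
    fix n g assume "g \<in> G (Suc n)"
    then obtain w where w: "AE x in lebesgue_on \<Omega>. norm (g x) \<le> 1" "has_weak_grad \<Omega> w g"
      "\<And>x. x \<in> \<Omega> \<Longrightarrow> \<bar>w x - v x\<bar> \<le> 1 / real (Suc (Suc n))"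
      unfolding G_def by blast
    have "1 / real (Suc (Suc n)) \<le> 1 / real (Suc n)" by (simp add: frac_le)
    then have "\<forall>x\<in>\<Omega>. \<bar>w x - v x\<bar> \<le> 1 / real (Suc n)" using w(3) order_trans by blast
    then show "g \<in> G n" using w(1,2) unfolding G_def by blast
  qed
  have Gm: "g \<in> borel_measurable (lebesgue_on \<Omega>)" if "g \<in> G n" for g n
    using that has_weak_grad_measurable[OF assms(1)] unfolding G_def by blast
  have Gb: "AE x in lebesgue_on \<Omega>. norm (g x) \<le> 1" if "g \<in> G n" for g n
    using that unfolding G_def by blast
  have Gmid: "(\<lambda>x. (1/2) *\<^sub>R f x + (1/2) *\<^sub>R g x) \<in> G n" if fg: "f \<in> G n" "g \<in> G n" for f g n
  proof -
    obtain w w' where w: "has_weak_grad \<Omega> w f" "\<And>x. x \<in> \<Omega> \<Longrightarrow> \<bar>w x - v x\<bar> \<le> 1 / real (Suc n)"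
      and w': "has_weak_grad \<Omega> w' g" "\<And>x. x \<in> \<Omega> \<Longrightarrow> \<bar>w' x - v x\<bar> \<le> 1 / real (Suc n)"
      using fg unfolding G_def by blast
    have "AE x in lebesgue_on \<Omega>. norm ((1/2) *\<^sub>R f x + (1/2) *\<^sub>R g x) \<le> 1"
      using Gb[OF fg(1)] Gb[OF fg(2)]
    proof eventually_elim
      case (elim x)
      then show ?case using norm_triangle_ineq[of "(1/2) *\<^sub>R f x" "(1/2) *\<^sub>R g x"] by simp
    qed
    moreover have "\<forall>x\<in>\<Omega>. \<bar>(1/2 * w x + 1/2 * w' x) - v x\<bar> \<le> 1 / real (Suc n)"
    proof
      fix x assume "x \<in> \<Omega>"
      then show "\<bar>(1/2 * w x + 1/2 * w' x) - v x\<bar> \<le> 1 / real (Suc n)"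
        using w(2)[of x] w'(2)[of x] by (simp add: abs_le_iff)
    qed
    ultimately show ?thesis
      unfolding G_def using has_weak_grad_linear[OF assms(1) w(1) w'(1), of "1/2" "1/2"] by blast
  qed
  obtain f g where f: "\<And>n. f n \<in> G n" and gm: "g \<in> borel_measurable (lebesgue_on \<Omega>)"
    and fg: "AE x in lebesgue_on \<Omega>. (\<lambda>n. f n x) \<longlonglongrightarrow> g x"
  proof (rule midpoint_convex_AE_convergent_selection[of G])
    fix f g
    assume "\<And>n. f n \<in> G n" "g \<in> borel_measurable (lebesgue_on \<Omega>)"
      "AE x in lebesgue_on \<Omega>. (\<lambda>n. f n x) \<longlonglongrightarrow> g x"
    then show thesis by (rule that)
  qed (rule ne decG Gm Gb Gmid; assumption)+
  have "\<exists>w. has_weak_grad \<Omega> w (f n) \<and> (\<forall>x\<in>\<Omega>. \<bar>w x - v x\<bar> \<le> 1 / real (Suc n))" for n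
    using f[of n] unfolding G_def by blast
  then obtain w where w: "\<And>n. has_weak_grad \<Omega> (w n) (f n)"
    "\<And>n x. x \<in> \<Omega> \<Longrightarrow> \<bar>w n x - v x\<bar> \<le> 1 / real (Suc n)"
    by metis
  have "AE x in lebesgue_on \<Omega>. \<forall>n. norm (f n x) \<le> 1"
    using Gb[OF f] by (simp add: AE_all_countable)
  with fg have g1: "AE x in lebesgue_on \<Omega>. norm (g x) \<le> 1"
  proof eventually_elim
    case (elim x)
    then show ?case by (intro LIMSEQ_le_const2[OF tendsto_norm[OF elim(1)]]) auto
  qed
  have "has_weak_grad \<Omega> v g"
    unfolding has_weak_grad_def has_weak_partial_def
  proof (intro ballI conjI allI impI)
    fix b :: 'a assume b: "b \<in> Basis"
    show locv: "locally_integrable \<Omega> v"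
      by (intro locally_integrable_continuous continuous_on_subset[OF contv sub])
    have "AE x in lebesgue_on \<Omega>. \<bar>g x \<bullet> b\<bar> \<le> 1"
      using g1 by eventually_elim (use Basis_le_norm[OF b] order_trans in blast)
    then show "locally_integrable \<Omega> (\<lambda>x. g x \<bullet> b)"
      by (intro locally_integrable_bounded[OF assms(1)]) (use gm in measurable)
    fix \<phi> assume \<phi>: "test_function \<Omega> \<phi>"
    obtain K where K: "compact K" "K \<subseteq> \<Omega>" "continuous_on UNIV \<phi>" "\<And>x. x \<notin> K \<Longrightarrow> \<phi> x = 0"
      "continuous_on UNIV (\<lambda>x. frechet_derivative \<phi> (at x) b)"
      "\<And>x. x \<notin> K \<Longrightarrow> frechet_derivative \<phi> (at x) b = 0"
      using test_function_support[OF \<phi>] b by metis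
    let ?D = "\<lambda>x. frechet_derivative \<phi> (at x) b"
    note I = integrable_mult_compact_support[OF assms(1) _ K(1,2)]
    have loc1: "locally_integrable \<Omega> (\<lambda>x. \<bar>v x\<bar> + 1)" "locally_integrable \<Omega> (\<lambda>x. 1)"
      by (intro locally_integrable_continuous continuous_intros continuous_on_subset[OF contv sub])+
    have wloc: "locally_integrable \<Omega> (w n)" "locally_integrable \<Omega> (\<lambda>x. f n x \<bullet> b)" for n
      using w(1)[of n] b by (auto simp: has_weak_grad_def has_weak_partial_def)
    have wlim: "(\<lambda>n. w n x) \<longlonglongrightarrow> v x" if "x \<in> \<Omega>" for x
    proof (rule LIM_zero_cancel, rule Lim_null_comparison)
      show "\<forall>\<^sub>F n in sequentially. norm (w n x - v x) \<le> 1 / real (Suc n)"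
        using w(2)[OF that] by simp
      show "(\<lambda>n. 1 / real (Suc n)) \<longlonglongrightarrow> 0" by (rule LIMSEQ_Suc[OF lim_1_over_n])
    qed
    have lhs: "(\<lambda>n. LINT x|lebesgue_on \<Omega>. w n x * ?D x) \<longlonglongrightarrow> (LINT x|lebesgue_on \<Omega>. v x * ?D x)"
    proof (rule integral_dominated_convergence[where w = "\<lambda>x. (\<bar>v x\<bar> + 1) * \<bar>?D x\<bar>"])
      show "(\<lambda>x. v x * ?D x) \<in> borel_measurable (lebesgue_on \<Omega>)"
        by (intro borel_measurable_integrable I[OF locv K(5,6)])
      show "(\<lambda>x. w n x * ?D x) \<in> borel_measurable (lebesgue_on \<Omega>)" for n
        by (intro borel_measurable_integrable I[OF wloc(1) K(5,6)])
      show "integrable (lebesgue_on \<Omega>) (\<lambda>x. (\<bar>v x\<bar> + 1) * \<bar>?D x\<bar>)"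
        by (rule I[OF loc1(1)]) (use K(5,6) in \<open>auto intro: continuous_intros\<close>)
      show "AE x in lebesgue_on \<Omega>. (\<lambda>n. w n x * ?D x) \<longlonglongrightarrow> v x * ?D x"
        using wlim by (intro AE_I2 tendsto_mult tendsto_const) auto
      show "AE x in lebesgue_on \<Omega>. norm (w n x * ?D x) \<le> (\<bar>v x\<bar> + 1) * \<bar>?D x\<bar>" for n
      proof (rule AE_I2)
        fix x assume "x \<in> space (lebesgue_on \<Omega>)"
        then have "\<bar>w n x - v x\<bar> \<le> 1 / real (Suc n)" using w(2) by simp
        also have "\<dots> \<le> 1" by simp
        finally have "\<bar>w n x\<bar> \<le> \<bar>v x\<bar> + 1" by linarith
        then show "norm (w n x * ?D x) \<le> (\<bar>v x\<bar> + 1) * \<bar>?D x\<bar>"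
          by (simp add: abs_mult mult_right_mono)
      qed
    qed
    have rhs: "(\<lambda>n. LINT x|lebesgue_on \<Omega>. f n x \<bullet> b * \<phi> x) \<longlonglongrightarrow> (LINT x|lebesgue_on \<Omega>. g x \<bullet> b * \<phi> x)"
    proof (rule integral_dominated_convergence[where w = "\<lambda>x. 1 * \<bar>\<phi> x\<bar>"])
      have [measurable]: "\<phi> \<in> borel_measurable (lebesgue_on \<Omega>)"
        using K(3) by (intro measurable_restrict_space1)
          (simp add: borel_measurable_continuous_onI measurable_completion)
      note [measurable] = gm Gm[OF f]
      show "(\<lambda>x. g x \<bullet> b * \<phi> x) \<in> borel_measurable (lebesgue_on \<Omega>)"
        "(\<lambda>x. f n x \<bullet> b * \<phi> x) \<in> borel_measurable (lebesgue_on \<Omega>)" for n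
        by measurable
      show "integrable (lebesgue_on \<Omega>) (\<lambda>x. 1 * \<bar>\<phi> x\<bar>)"
        by (rule I[OF loc1(2)]) (use K(3,4) in \<open>auto intro: continuous_intros\<close>)
      show "AE x in lebesgue_on \<Omega>. (\<lambda>n. f n x \<bullet> b * \<phi> x) \<longlonglongrightarrow> g x \<bullet> b * \<phi> x"
        using fg by eventually_elim (intro tendsto_intros)
      show "AE x in lebesgue_on \<Omega>. norm (f n x \<bullet> b * \<phi> x) \<le> 1 * \<bar>\<phi> x\<bar>" for n
        using Gb[OF f[of n]]
      proof eventually_elim
        case (elim x)
        then have "\<bar>f n x \<bullet> b\<bar> \<le> 1" using Basis_le_norm[OF b, of "f n x"] by linarith
        then show ?case unfolding abs_mult real_norm_def by (rule mult_right_mono) simp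
      qed
    qed
    have "(LINT x|lebesgue_on \<Omega>. w n x * ?D x) = - (LINT x|lebesgue_on \<Omega>. f n x \<bullet> b * \<phi> x)" for n
      using w(1)[of n] b \<phi> by (auto simp: has_weak_grad_def has_weak_partial_def)
    then show "(LINT x|lebesgue_on \<Omega>. v x * ?D x) = - (LINT x|lebesgue_on \<Omega>. g x \<bullet> b * \<phi> x)"
      using LIMSEQ_unique[OF lhs] tendsto_minus[OF rhs] by simp
  qed
  then show ?thesis
    using K0_iff[OF assms(1,2)] contv zerov g1 by blast
qed

section \<open>The potential\<close>

text \<open>
  A Caratheodory function is a limit of functions piecewise constant in the second variable, hence
  jointly measurable after the exceptional null set is removed; the primitive is then an integral
  with a parameter.
\<close>

lemma measurable_primitive_compose:
  fixes \<Omega> :: "'a::euclidean_space set"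
  assumes "open \<Omega>" "caratheodory \<Omega> h" and u [measurable]: "u \<in> borel_measurable (lebesgue_on \<Omega>)"
  shows "(\<lambda>x. primitive h x (u x)) \<in> borel_measurable (lebesgue_on \<Omega>)"
proof -
  let ?M = "lebesgue_on \<Omega>"
  have hm [measurable]: "(\<lambda>x. h x s) \<in> borel_measurable ?M" for s
    using assms(2) by (simp add: caratheodory_def)
  obtain N where N: "{x \<in> space ?M. \<not> continuous_on UNIV (h x)} \<subseteq> N" "emeasure ?M N = 0"
    and Ns [measurable]: "N \<in> sets ?M"
    using assms(2) AE_E[of "\<lambda>x. continuous_on UNIV (h x)" ?M] unfolding caratheodory_def by metis
  \<comment> \<open>On the null set \<open>N\<close> the function \<open>h x\<close> may fail to be continuous.\<close>
  define k where "k x \<tau> = (if x \<in> N then 0 else h x \<tau>)" for x \<tau>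
  have km [measurable]: "(\<lambda>p. k (fst p) (snd p)) \<in> borel_measurable (?M \<Otimes>\<^sub>M lborel)"
  proof (rule borel_measurable_LIMSEQ_real)
    let ?fl = "\<lambda>n p. \<lfloor>real (Suc n) * snd p\<rfloor>"
    show "(\<lambda>p. k (fst p) (real_of_int (?fl n p) / real (Suc n))) \<in> borel_measurable (?M \<Otimes>\<^sub>M lborel)"
      for n
    proof (rule measurable_compose_countable[where
          f = "\<lambda>i p. k (fst p) (real_of_int i / real (Suc n))" and g = "?fl n"])
      show "(\<lambda>p. k (fst p) (real_of_int i / real (Suc n))) \<in> borel_measurable (?M \<Otimes>\<^sub>M lborel)" for i
        unfolding k_def by measurable
      have "(\<lambda>p. real (Suc n) * snd p) \<in> borel_measurable (?M \<Otimes>\<^sub>M lborel)" by measurable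
      then show "?fl n \<in> measurable (?M \<Otimes>\<^sub>M lborel) (count_space UNIV)"
        by (rule measurable_compose) (rule measurable_real_floor)
    qed
    fix p :: "'a \<times> real" assume p: "p \<in> space (?M \<Otimes>\<^sub>M lborel)"
    show "(\<lambda>n. k (fst p) (real_of_int (?fl n p) / real (Suc n))) \<longlonglongrightarrow> k (fst p) (snd p)"
    proof (cases "fst p \<in> N")
      case False
      then have c: "continuous_on UNIV (h (fst p))" using N(1) p by (auto simp: space_pair_measure)
      have "(\<lambda>n. real_of_int (?fl n p) / real (Suc n)) \<longlonglongrightarrow> snd p"
      proof (rule LIM_zero_cancel, rule Lim_null_comparison)
        have "\<bar>real_of_int (?fl n p) / real (Suc n) - snd p\<bar> \<le> 1 / real (Suc n)" for n
        proof -
          have "\<bar>real_of_int (?fl n p) - real (Suc n) * snd p\<bar> \<le> 1" by linarith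
          then have "\<bar>real_of_int (?fl n p) - real (Suc n) * snd p\<bar> / real (Suc n) \<le> 1 / real (Suc n)"
            by (rule divide_right_mono) simp
          moreover have "real_of_int (?fl n p) / real (Suc n) - snd p
              = (real_of_int (?fl n p) - real (Suc n) * snd p) / real (Suc n)"
            by (simp add: diff_divide_distrib del: of_nat_Suc)
          ultimately show ?thesis by (simp only: abs_divide abs_of_nat)
        qed
        then show "\<forall>\<^sub>F n in sequentially.
            norm (real_of_int (?fl n p) / real (Suc n) - snd p) \<le> 1 / real (Suc n)"
          by (intro always_eventually allI) (simp only: real_norm_def)
        show "(\<lambda>n. 1 / real (Suc n)) \<longlonglongrightarrow> 0" by (rule LIMSEQ_Suc[OF lim_1_over_n])
      qed
      then show ?thesis
        using continuous_on_tendsto_compose[OF c] False by (simp add: k_def)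
    qed (simp add: k_def)
  qed
  define P where "P x = (if 0 \<le> u x then LINT \<tau>|lborel. (if 0 < \<tau> \<and> \<tau> < u x then k x \<tau> else 0)
    else - (LINT \<tau>|lborel. (if u x < \<tau> \<and> \<tau> < 0 then k x \<tau> else 0)))" for x
  have "(\<lambda>x. LINT \<tau>|lborel. (if 0 < \<tau> \<and> \<tau> < u x then k x \<tau> else 0)) \<in> borel_measurable ?M"
    "(\<lambda>x. LINT \<tau>|lborel. (if u x < \<tau> \<and> \<tau> < 0 then k x \<tau> else 0)) \<in> borel_measurable ?M"
    by (intro lborel.borel_measurable_lebesgue_integral, unfold split_beta', measurable)+
  then have "P \<in> borel_measurable ?M" unfolding P_def by measurable
  then have "(\<lambda>x. indicator \<Omega> x *\<^sub>R P x) \<in> borel_measurable lebesgue"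
    using assms(1) by (simp add: borel_measurable_restrict_space_iff)
  moreover have "AE x in ?M. x \<notin> N"
    using N(2) Ns by (intro AE_not_in) (auto simp: null_sets_def)
  then have "AE x in lebesgue. x \<in> \<Omega> \<longrightarrow> x \<notin> N" using assms(1) by (simp add: AE_restrict_space_iff)
  then have "AE x in lebesgue. indicator \<Omega> x *\<^sub>R P x = indicator \<Omega> x *\<^sub>R primitive h x (u x)"
  proof eventually_elim
    case (elim x)
    have "P x = primitive h x (u x)" if "x \<notin> N"
    proof -
      have "(if a < \<tau> \<and> \<tau> < b then k x \<tau> else 0) = indicator {a<..<b} \<tau> *\<^sub>R h x \<tau>" for a b \<tau>
        using that by (auto simp: k_def indicator_def)
      then show ?thesis
        by (simp add: P_def primitive_def interval_lebesgue_integral_def set_lebesgue_integral_def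
            einterval_eq_Icc[of 0 "u x", folded zero_ereal_def]
            einterval_eq_Icc[of "u x" 0, folded zero_ereal_def])
    qed
    then show ?case using elim by (auto simp: indicator_def)
  qed
  ultimately have "(\<lambda>x. indicator \<Omega> x *\<^sub>R primitive h x (u x)) \<in> borel_measurable lebesgue"
    by (rule borel_measurable_AE)
  then show ?thesis using assms(1) by (simp add: borel_measurable_restrict_space_iff)
qed

text \<open>By the fundamental theorem of calculus \<open>h x\<close> is the derivative of \<open>primitive h x\<close>.\<close>

lemma primitive_lipschitz:
  assumes cont: "continuous_on UNIV (h x)" and B: "\<And>s. \<bar>s\<bar> \<le> R \<Longrightarrow> \<bar>h x s\<bar> \<le> B"
    and "0 \<le> R" "\<bar>s\<bar> \<le> R" "\<bar>t\<bar> \<le> R"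
  shows "\<bar>primitive h x s - primitive h x t\<bar> \<le> B * \<bar>s - t\<bar>"
proof -
  have "norm (primitive h x s - primitive h x t) \<le> B * norm (s - t)"
  proof (rule field_differentiable_bound[of "{-R..R}" "primitive h x" "h x"])
    fix z assume z: "z \<in> {-R..R}"
    have "((\<lambda>u. LBINT y=ereal 0..ereal u. h x y) has_vector_derivative h x z) (at z within {-R..R})"
      by (rule interval_integral_FTC2) (use z assms(3) continuous_on_subset[OF cont] in auto)
    then show "(primitive h x has_field_derivative h x z) (at z within {-R..R})"
      by (simp add: primitive_def[abs_def] has_real_derivative_iff_has_vector_derivative)
    show "norm (h x z) \<le> B" using B z by auto
  qed (use assms in auto)
  then show ?thesis by simp
qed

lemma primitive_0: "primitive h x 0 = 0"
  by (simp add: primitive_def)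

lemma hyp_h1_bound:
  assumes "hyp_h1 \<Omega> h" "R > 0"
  shows "\<exists>B\<ge>0. AE x in lebesgue_on \<Omega>. continuous_on UNIV (h x) \<and> (\<forall>s. \<bar>s\<bar> \<le> R \<longrightarrow> \<bar>h x s\<bar> \<le> B)"
proof -
  obtain \<alpha> where \<alpha>: "\<alpha> \<in> Lp_space \<infinity> \<Omega>"
    "AE x in lebesgue_on \<Omega>. \<forall>s. \<bar>s\<bar> \<le> R \<longrightarrow> \<bar>h x s\<bar> \<le> \<alpha> x"
    using assms unfolding hyp_h1_def by blast
  have "esssup (lebesgue_on \<Omega>) (\<lambda>x. ereal \<bar>\<alpha> x\<bar>) < \<infinity>" using \<alpha>(1) by (simp add: Lp_space_def)
  then obtain B where B: "esssup (lebesgue_on \<Omega>) (\<lambda>x. ereal \<bar>\<alpha> x\<bar>) \<le> ereal B"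
    by (metis less_ereal.simps(2) less_imp_le ereal_dense2)
  have "AE x in lebesgue_on \<Omega>. continuous_on UNIV (h x)"
    using assms(1) by (simp add: hyp_h1_def caratheodory_def)
  with \<alpha>(2) esssup_AE[where M = "lebesgue_on \<Omega>" and f = "\<lambda>x. ereal \<bar>\<alpha> x\<bar>"]
  have "AE x in lebesgue_on \<Omega>.
      continuous_on UNIV (h x) \<and> (\<forall>s. \<bar>s\<bar> \<le> R \<longrightarrow> \<bar>h x s\<bar> \<le> max B 0)"
  proof eventually_elim
    case (elim x)
    have "ereal \<bar>\<alpha> x\<bar> \<le> ereal B" using elim(2) B by (rule order_trans)
    then have "\<alpha> x \<le> max B 0" by auto
    then show ?case using elim(1,3) order_trans by blast
  qed
  then show ?thesis by (intro exI[of _ "max B 0"]) auto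
qed

lemma potential_tendsto:
  fixes \<Omega> :: "'a::euclidean_space set"
  assumes "open \<Omega>" "bounded \<Omega>" "hyp_h1 \<Omega> h" "R > 0"
    and u: "\<And>n. u n \<in> borel_measurable (lebesgue_on \<Omega>)" "\<And>n x. x \<in> \<Omega> \<Longrightarrow> \<bar>u n x\<bar> \<le> R"
    and v: "v \<in> borel_measurable (lebesgue_on \<Omega>)" "\<And>x. x \<in> \<Omega> \<Longrightarrow> (\<lambda>n. u n x) \<longlonglongrightarrow> v x"
  shows "(\<lambda>n. potential \<Omega> h (u n)) \<longlonglongrightarrow> potential \<Omega> h v"
proof -
  interpret finite_measure "lebesgue_on \<Omega>"
    by (rule finite_measure_lebesgue_on[OF lmeasurable_open[OF assms(2,1)]])
  obtain B where B: "B \<ge> 0"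
    "AE x in lebesgue_on \<Omega>. continuous_on UNIV (h x) \<and> (\<forall>s. \<bar>s\<bar> \<le> R \<longrightarrow> \<bar>h x s\<bar> \<le> B)"
    using hyp_h1_bound[OF assms(3,4)] by blast
  have car: "caratheodory \<Omega> h" using assms(3) by (simp add: hyp_h1_def)
  have vR: "\<bar>v x\<bar> \<le> R" if "x \<in> \<Omega>" for x
    by (rule LIMSEQ_le_const2[OF tendsto_rabs[OF v(2)[OF that]]]) (use u(2)[OF that] in auto)
  have space: "AE x in lebesgue_on \<Omega>. x \<in> \<Omega>" by (rule AE_I2) simp
  show ?thesis unfolding potential_def
  proof (rule integral_dominated_convergence[where w = "\<lambda>_. B * R"])
    show "(\<lambda>x. primitive h x (v x)) \<in> borel_measurable (lebesgue_on \<Omega>)"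
      by (rule measurable_primitive_compose[OF assms(1) car v(1)])
    show "(\<lambda>x. primitive h x (u n x)) \<in> borel_measurable (lebesgue_on \<Omega>)" for n
      by (rule measurable_primitive_compose[OF assms(1) car u(1)])
    show "AE x in lebesgue_on \<Omega>. (\<lambda>n. primitive h x (u n x)) \<longlonglongrightarrow> primitive h x (v x)"
      using B(2) space
    proof eventually_elim
      case (elim x)
      have lip: "\<bar>primitive h x (u n x) - primitive h x (v x)\<bar> \<le> B * \<bar>u n x - v x\<bar>" for n
        by (rule primitive_lipschitz[of h x R B]) (use elim assms(4) u(2) vR in auto)
      show ?case
      proof (rule LIM_zero_cancel, rule Lim_null_comparison)
        show "\<forall>\<^sub>F n in sequentially.
            norm (primitive h x (u n x) - primitive h x (v x)) \<le> B * \<bar>u n x - v x\<bar>"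
          using lip by simp
        show "(\<lambda>n. B * \<bar>u n x - v x\<bar>) \<longlonglongrightarrow> 0"
          using v(2)[OF elim(2)] by (intro tendsto_mult_right_zero tendsto_rabs_zero LIM_zero)
      qed
    qed
    show "AE x in lebesgue_on \<Omega>. norm (primitive h x (u n x)) \<le> B * R" for n
      using B(2) space
    proof eventually_elim
      case (elim x)
      have "\<bar>primitive h x (u n x) - primitive h x 0\<bar> \<le> B * \<bar>u n x - 0\<bar>"
        by (rule primitive_lipschitz[of h x R B]) (use elim assms(4) u(2) in auto)
      also have "\<dots> \<le> B * R" using u(2)[OF elim(2), of n] B(1) by (intro mult_left_mono) auto
      finally show ?case by (simp add: primitive_0)
    qed
  qed simp
qed

section \<open>Minimizers for large parameters\<close>

lemma zero_in_K0:
  fixes \<Omega> :: "'a::euclidean_space set"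
  assumes "open \<Omega>" "bounded \<Omega>"
  shows "(\<lambda>_. 0) \<in> K0 \<Omega>"
proof -
  have "locally_integrable \<Omega> (\<lambda>_. 0)" by (rule locally_integrable_continuous) simp
  then have "has_weak_grad \<Omega> (\<lambda>_. 0) (\<lambda>_. 0)" by (simp add: has_weak_grad_def has_weak_partial_def)
  then show ?thesis using K0_iff[OF assms, of "\<lambda>_. 0"] by force
qed

lemma energy_K0:
  "u \<in> K0 \<Omega> \<Longrightarrow> energy \<Omega> h lam \<mu> u = ereal (real_of_ereal (Psi \<Omega> u)
    - lam / 2 * (LINT x|lebesgue_on \<Omega>. (u x)\<^sup>2) - \<mu> * potential \<Omega> h u)"
  by (simp add: energy_def Psi_def)

lemma Psi_K0_bounds:
  fixes \<Omega> :: "'a::euclidean_space set"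
  assumes "open \<Omega>" "bounded \<Omega>" "u \<in> K0 \<Omega>"
  shows "0 \<le> real_of_ereal (Psi \<Omega> u)" "real_of_ereal (Psi \<Omega> u) \<le> measure lebesgue \<Omega>"
proof -
  interpret finite_measure "lebesgue_on \<Omega>"
    by (rule finite_measure_lebesgue_on[OF lmeasurable_open[OF assms(2,1)]])
  let ?f = "\<lambda>x. 1 - sqrt (1 - (norm (weak_grad \<Omega> u x))\<^sup>2)"
  obtain g where g: "has_weak_grad \<Omega> u g" "AE x in lebesgue_on \<Omega>. norm (g x) \<le> 1"
    using assms(3) K0_iff[OF assms(1,2)] by blast
  have bounds: "AE x in lebesgue_on \<Omega>. 0 \<le> ?f x \<and> ?f x \<le> 1"
    using weak_grad_AE_eq[OF assms(1) g(1)] g(2)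
    by eventually_elim (simp add: power_le_one)
  have eq: "real_of_ereal (Psi \<Omega> u) = (LINT x|lebesgue_on \<Omega>. ?f x)"
    using assms(3) by (simp add: Psi_def)
  show "0 \<le> real_of_ereal (Psi \<Omega> u)"
    unfolding eq by (rule integral_nonneg_AE) (use bounds in auto)
  have "(LINT x|lebesgue_on \<Omega>. ?f x) \<le> (LINT x|lebesgue_on \<Omega>. 1)"
    by (rule integral_mono_AE') (use bounds in auto)
  then show "real_of_ereal (Psi \<Omega> u) \<le> measure lebesgue \<Omega>"
    using assms(1) by (simp add: eq measure_restrict_space)
qed

text \<open>
  Comparison of a minimizer with a competitor: dividing by \<open>\<mu>\<close>, everything but the potential is
  bounded uniformly on \<open>K0\<close>.
\<close>

lemma minimizer_potential_bound:
  fixes \<Omega> :: "'a::euclidean_space set"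
  assumes "open \<Omega>" "bounded \<Omega>"
  shows "\<exists>C. \<forall>\<mu>>0. \<forall>u\<in>K0 \<Omega>. \<forall>v\<in>K0 \<Omega>. energy \<Omega> h lam \<mu> u \<le> energy \<Omega> h lam \<mu> v \<longrightarrow>
    potential \<Omega> h v \<le> potential \<Omega> h u + C / \<mu>"
proof -
  interpret finite_measure "lebesgue_on \<Omega>"
    by (rule finite_measure_lebesgue_on[OF lmeasurable_open[OF assms(2,1)]])
  obtain R where R: "R > 0" "\<And>u x. u \<in> K0 \<Omega> \<Longrightarrow> x \<in> closure \<Omega> \<Longrightarrow> \<bar>u x\<bar> \<le> R"
    using K0_bounded[OF assms] by blast
  define m where "m = measure lebesgue \<Omega>"
  define q where "q u = lam / 2 * (LINT x|lebesgue_on \<Omega>. (u x)\<^sup>2)" for u :: "'a \<Rightarrow> real"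
  have q: "\<bar>q u\<bar> \<le> \<bar>lam\<bar> / 2 * (R\<^sup>2 * m)" if "u \<in> K0 \<Omega>" for u
  proof -
    have "(u x)\<^sup>2 \<le> R\<^sup>2" if "x \<in> \<Omega>" for x
      using R(2)[OF \<open>u \<in> K0 \<Omega>\<close>, of x] that closure_subset abs_le_square_iff[of "u x" R] R(1) by auto
    then have "(LINT x|lebesgue_on \<Omega>. (u x)\<^sup>2) \<le> (LINT x|lebesgue_on \<Omega>. R\<^sup>2)"
      by (intro integral_mono_AE') (auto intro!: AE_I2)
    also have "\<dots> = R\<^sup>2 * m" using assms(1) by (simp add: m_def measure_restrict_space)
    finally have "(LINT x|lebesgue_on \<Omega>. (u x)\<^sup>2) \<le> R\<^sup>2 * m" .
    moreover have "0 \<le> (LINT x|lebesgue_on \<Omega>. (u x)\<^sup>2)" by simp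
    ultimately show ?thesis unfolding q_def abs_mult by (intro mult_mono) auto
  qed
  define C where "C = m + \<bar>lam\<bar> * (R\<^sup>2 * m)"
  have "potential \<Omega> h v \<le> potential \<Omega> h u + C / \<mu>"
    if "\<mu> > 0" "u \<in> K0 \<Omega>" "v \<in> K0 \<Omega>" "energy \<Omega> h lam \<mu> u \<le> energy \<Omega> h lam \<mu> v" for \<mu> u v
  proof -
    have "real_of_ereal (Psi \<Omega> u) - q u - \<mu> * potential \<Omega> h u
        \<le> real_of_ereal (Psi \<Omega> v) - q v - \<mu> * potential \<Omega> h v"
      using that(4) unfolding energy_K0[OF that(2)] energy_K0[OF that(3)] q_def by simp
    moreover have "q u \<le> \<bar>lam\<bar> / 2 * (R\<^sup>2 * m)" "- q v \<le> \<bar>lam\<bar> / 2 * (R\<^sup>2 * m)"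
      using q[OF that(2)] q[OF that(3)] by linarith+
    ultimately have "\<mu> * potential \<Omega> h v \<le> \<mu> * potential \<Omega> h u + C"
      using Psi_K0_bounds(1)[OF assms that(2)] Psi_K0_bounds(2)[OF assms that(3)]
      unfolding C_def m_def by linarith
    then show ?thesis using that(1) by (simp add: field_simps)
  qed
  then show ?thesis by blast
qed

text \<open>The zero function has finite energy, so a minimizer has finite energy and lies in \<open>K0 \<Omega>\<close>.\<close>

lemma minimizer_in_K0:
  fixes \<Omega> :: "'a::euclidean_space set"
  assumes "open \<Omega>" "bounded \<Omega>" "energy \<Omega> h lam \<mu> u = inf_energy \<Omega> h lam \<mu>"
  shows "u \<in> K0 \<Omega>" and "v \<in> K0 \<Omega> \<Longrightarrow> energy \<Omega> h lam \<mu> u \<le> energy \<Omega> h lam \<mu> v"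
proof -
  show le: "energy \<Omega> h lam \<mu> u \<le> energy \<Omega> h lam \<mu> v" if "v \<in> K0 \<Omega>" for v
    unfolding assms(3) inf_energy_def using that by (intro INF_lower) (simp add: K0_def)
  show "u \<in> K0 \<Omega>"
  proof (rule ccontr)
    assume "u \<notin> K0 \<Omega>"
    then have "energy \<Omega> h lam \<mu> u = \<infinity>" by (simp add: energy_def Psi_def)
    then show False using le[OF zero_in_K0[OF assms(1,2)]] energy_K0[OF zero_in_K0[OF assms(1,2)]]
      by (metis ereal_infty_less_eq(1) PInfty_neq_ereal(1))
  qed
qed

lemma minimizers_subconverge:
  fixes \<Omega> :: "'a::euclidean_space set"
  assumes "open \<Omega>" "bounded \<Omega>" "hyp_h1 \<Omega> h"
    and min: "\<And>\<mu>. \<mu> > \<mu>0 \<Longrightarrow> energy \<Omega> h lam \<mu> (u \<mu>) = inf_energy \<Omega> h lam \<mu>"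
  shows "subconverges_to_maximizer \<Omega> h u"
  unfolding subconverges_to_maximizer_def
proof (intro allI impI)
  fix m :: "nat \<Rightarrow> real" assume m: "filterlim m at_top sequentially"
  have "\<forall>\<^sub>F n in sequentially. m n > max \<mu>0 0"
    using m unfolding filterlim_at_top_dense by blast
  then obtain n0 where n0: "\<And>n. n \<ge> n0 \<Longrightarrow> m n > \<mu>0 \<and> m n > 0"
    by (auto simp: eventually_sequentially)
  \<comment> \<open>The finitely many parameters at the start need not be admissible; they are dropped.\<close>
  define w where "w n = u (m (n + n0))" for n
  have wK: "w n \<in> K0 \<Omega>" for n
    unfolding w_def using n0 by (intro minimizer_in_K0(1)[OF assms(1,2) min]) simp
  obtain R where R: "R > 0" "\<And>u x. u \<in> K0 \<Omega> \<Longrightarrow> x \<in> closure \<Omega> \<Longrightarrow> \<bar>u x\<bar> \<le> R"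
    using K0_bounded[OF assms(1,2)] by blast
  obtain v k where k: "strict_mono (k :: nat \<Rightarrow> nat)"
    and v: "\<And>e. 0 < e \<Longrightarrow> \<exists>N. \<forall>n x. n \<ge> N \<and> x \<in> closure \<Omega> \<longrightarrow> norm (w (k n) x - v x) < e"
  proof (rule Arzela_Ascoli[of "closure \<Omega>" w R])
    show "compact (closure \<Omega>)" using assms(2) by (simp add: compact_closure)
    show "norm (w n x) \<le> R" if "x \<in> closure \<Omega>" for n x using R(2)[OF wK that] by simp
    fix x e assume x: "x \<in> closure \<Omega>" and e: "(0::real) < e"
    have "norm (w n x - w n y) < e" if "y \<in> closure \<Omega>" "norm (x - y) < e" for n y
      using K0_lipschitz[OF assms(1,2) wK x that(1), of n] that(2) by (simp add: dist_norm)
    then show "\<exists>d. 0 < d \<and> (\<forall>n y. y \<in> closure \<Omega> \<and> norm (x - y) < d \<longrightarrow> norm (w n x - w n y) < e)"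
      using e by blast
  qed blast
  have lim: "uniform_limit (closure \<Omega>) (\<lambda>n. w (k n)) v sequentially"
    unfolding uniform_limit_iff eventually_sequentially dist_norm using v by blast
  have vK: "v \<in> K0 \<Omega>" by (rule K0_uniform_limit[OF assms(1,2) wK lim])
  have meas: "f \<in> borel_measurable (lebesgue_on \<Omega>)" if "f \<in> K0 \<Omega>" for f
  proof (rule continuous_imp_measurable_on_sets_lebesgue)
    show "continuous_on \<Omega> f"
      using that closure_subset by (auto simp: K0_def intro: continuous_on_subset)
  qed (use assms(1) in simp)
  have pot: "(\<lambda>n. potential \<Omega> h (w (k n))) \<longlonglongrightarrow> potential \<Omega> h v"
  proof (rule potential_tendsto[OF assms(1-3) R(1)])
    show "\<bar>w (k n) x\<bar> \<le> R" if "x \<in> \<Omega>" for n x using R(2)[OF wK] that closure_subset by blast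
    show "(\<lambda>n. w (k n) x) \<longlonglongrightarrow> v x" if "x \<in> \<Omega>" for x
      using tendsto_uniform_limitI[OF lim] that closure_subset by blast
  qed (intro meas wK vK)+
  obtain C where C: "\<And>\<mu> f g. \<mu> > 0 \<Longrightarrow> f \<in> K0 \<Omega> \<Longrightarrow> g \<in> K0 \<Omega> \<Longrightarrow>
      energy \<Omega> h lam \<mu> f \<le> energy \<Omega> h lam \<mu> g \<Longrightarrow> potential \<Omega> h g \<le> potential \<Omega> h f + C / \<mu>"
    using minimizer_potential_bound[OF assms(1,2), of h lam] by blast
  have "potential \<Omega> h g \<le> potential \<Omega> h v" if g: "g \<in> K0 \<Omega>" for g
  proof (rule LIMSEQ_le_const)
    have "filterlim (\<lambda>n. m (k n + n0)) at_top sequentially"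
      using filterlim_compose[OF m filterlim_compose[OF filterlim_add_const_nat_at_top
            filterlim_subseq[OF k], of n0]] .
    then have "(\<lambda>n. C / m (k n + n0)) \<longlonglongrightarrow> 0"
      by (intro tendsto_divide_0[OF tendsto_const] filterlim_at_top_imp_at_infinity)
    then show "(\<lambda>n. potential \<Omega> h (w (k n)) + C / m (k n + n0)) \<longlonglongrightarrow> potential \<Omega> h v"
      using tendsto_add[OF pot] by fastforce
    have "potential \<Omega> h g \<le> potential \<Omega> h (w (k n)) + C / m (k n + n0)" for n
    proof (rule C[OF _ wK g])
      show "energy \<Omega> h lam (m (k n + n0)) (w (k n)) \<le> energy \<Omega> h lam (m (k n + n0)) g"
        unfolding w_def using n0 by (intro minimizer_in_K0(2)[OF assms(1,2) min g]) simp
    qed (use n0 in simp)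
    then show "\<exists>N. \<forall>n\<ge>N. potential \<Omega> h g \<le> potential \<Omega> h (w (k n)) + C / m (k n + n0)" by blast
  qed
  then have "is_arg_max (potential \<Omega> h) (\<lambda>v. v \<in> K0 \<Omega>) v"
    using vK by (force simp: is_arg_max_def)
  moreover have "strict_mono (\<lambda>n. k n + n0)" using k by (simp add: strict_mono_def)
  moreover have "uniform_limit (closure \<Omega>) (\<lambda>n. u (m (k n + n0))) v sequentially"
    using lim by (simp add: w_def)
  ultimately show "\<exists>r u_inf. strict_mono r \<and>
      uniform_limit (closure \<Omega>) (\<lambda>n. u (m (r n))) u_inf sequentially \<and>
      is_arg_max (potential \<Omega> h) (\<lambda>v. v \<in> K0 \<Omega>) u_inf"
    by blast
qed

theorem proposition2p18:
  fixes \<Omega> :: "'a::euclidean_space set"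
    and h :: "'a \<Rightarrow> real \<Rightarrow> real"
    and lam :: real
  assumes "DIM('a) \<ge> 2"
    and "bounded_Ck_domain 2 \<Omega>"
    and "hyp_h1 \<Omega> h"
  shows "(\<forall>M>0. \<forall>u :: real \<Rightarrow> 'a \<Rightarrow> real.
      (\<forall>\<mu>\<ge>M. is_solution \<Omega> h lam \<mu> (u \<mu>) \<and> energy \<Omega> h lam \<mu> (u \<mu>) = inf_energy \<Omega> h lam \<mu>)
      \<longrightarrow> subconverges_to_maximizer \<Omega> h u) \<and>
    ((\<exists>\<delta>>0. AE x in lebesgue_on \<Omega>. \<forall>s\<in>{-\<delta><..<\<delta>} - {0}. h x s * s > 0)
      \<longrightarrow> (\<forall>\<mu>0. \<forall>u :: real \<Rightarrow> 'a \<Rightarrow> real.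
        (\<forall>\<mu>>\<mu>0. is_solution \<Omega> h lam \<mu> (u \<mu>) \<and> (\<exists>x\<in>\<Omega>. u \<mu> x \<noteq> 0) \<and>
           energy \<Omega> h lam \<mu> (u \<mu>) = inf_energy \<Omega> h lam \<mu> \<and> inf_energy \<Omega> h lam \<mu> < 0)
        \<longrightarrow> subconverges_to_maximizer \<Omega> h u))"
proof -
  have \<Omega>: "open \<Omega>" "bounded \<Omega>" using assms(2) by (auto simp: bounded_Ck_domain_def)
  show ?thesis
  proof (intro conjI allI impI)
    fix M :: real and u :: "real \<Rightarrow> 'a \<Rightarrow> real"
    assume "\<forall>\<mu>\<ge>M. is_solution \<Omega> h lam \<mu> (u \<mu>) \<and> energy \<Omega> h lam \<mu> (u \<mu>) = inf_energy \<Omega> h lam \<mu>"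
    then show "subconverges_to_maximizer \<Omega> h u"
      by (intro minimizers_subconverge[OF \<Omega> assms(3), of M lam]) simp
  next
    fix \<mu>0 :: real and u :: "real \<Rightarrow> 'a \<Rightarrow> real"
    assume "\<forall>\<mu>>\<mu>0. is_solution \<Omega> h lam \<mu> (u \<mu>) \<and> (\<exists>x\<in>\<Omega>. u \<mu> x \<noteq> 0) \<and>
      energy \<Omega> h lam \<mu> (u \<mu>) = inf_energy \<Omega> h lam \<mu> \<and> inf_energy \<Omega> h lam \<mu> < 0"
    then show "subconverges_to_maximizer \<Omega> h u"
      by (intro minimizers_subconverge[OF \<Omega> assms(3), of \<mu>0 lam]) simp
  qed
qed

end
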